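(* Let $E$ be a finite ground set with $|E|=n$, let $f,g\colon 2^E\to\mathbb{R}_{\ge 0}$ be monotone submodular functions, and let $\mathcal{M}=(E,\mathcal{I})$ be a matroid. Then there exists a polynomial-time algorithm that approximates $\max_{S\subseteq E,\,S\in\mathcal{I}}\frac{f(S)}{g(S)}$ within an $O(\sqrt{n}\log n)$ factor.
   Context: A set function $f$ is submodular if $f(S\cup\{e\})-f(S)\ge f(T\cup\{e\})-f(T)$ for all $S\subseteq T\subseteq E$, $e\in E\setminus T$, and monotone if $f(S)\le f(T)$ whenever $S\subseteq T$. A matroid $\mathcal{M}=(E,\mathcal{I})$ satisfies $\emptyset\in\mathcal{I}$, closure of $\mathcal{I}$ under subsets, and the exchange property. The functions and the matroid are accessed via value/independence oracles. *)

theory Defs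
  imports
    "HOL-Library.Landau_Symbols"
    "HOL-Library.Extended_Nonnegative_Real"
    "HOL-Computational_Algebra.Polynomial"
begin

definition submodular_on :: "'a set \<Rightarrow> ('a set \<Rightarrow> real) \<Rightarrow> bool" where
  "submodular_on E f \<longleftrightarrow>
     (\<forall>S T e. S \<subseteq> T \<and> T \<subseteq> E \<and> e \<in> E - T \<longrightarrow>
        f (S \<union> {e}) - f S \<ge> f (T \<union> {e}) - f T)"

locale matroid =
  fixes E :: "'a set" and \<I> :: "'a set set"
  assumes finite_ground: "finite E"
    and indep_subset_ground: "\<I> \<subseteq> Pow E"
    and empty_indep: "{} \<in> \<I>"
    and indep_subset: "A \<subseteq> B \<Longrightarrow> B \<in> \<I> \<Longrightarrow> A \<in> \<I>"
    and exchange: "A \<in> \<I> \<Longrightarrow> B \<in> \<I> \<Longrightarrow> card A < card B \<Longrightarrow> \<exists>x \<in> B - A. insert x A \<in> \<I>"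

text \<open>
  The quotient is formed in \<open>[0, \<infinity>]\<close>, since \<open>g\<close> may vanish on some (for example
  the empty) independent set: \<open>x / 0 = \<infinity>\<close> for \<open>x > 0\<close>, and \<open>0 / 0 = 0\<close>, so that a
  set with undefined quotient never beats another set.
\<close>

definition ratio :: "('a set \<Rightarrow> real) \<Rightarrow> ('a set \<Rightarrow> real) \<Rightarrow> 'a set \<Rightarrow> ennreal" where
  "ratio f g S = ennreal (f S) / ennreal (g S)"

text \<open>
  The model of computation is a deterministic real random access machine with oracles,
  presented as a structured while-language. Every variable is an unbounded array, either of
  natural numbers (counters, addresses, characteristic vectors) or of reals (function values);
  a scalar is an array used at one index only.

  On reals there are the field operations and exact comparison, but no rounding and no
  constants other than those built from naturals. On naturals there are only addition and
  truncated subtraction: with multiplication at unit cost, numbers of exponential bit length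
  would be available in polynomial time.
\<close>

type_synonym vname = string

datatype nexp =
    NConst nat
  | NAt vname nexp
  | NAdd nexp nexp
  | NSub nexp nexp

datatype rexp =
    RNat nexp
  | RAt vname nexp
  | RAdd rexp rexp
  | RSub rexp rexp
  | RMul rexp rexp
  | RDiv rexp rexp

datatype bexp =
    NLess nexp nexp
  | RLess rexp rexp
  | BNot bexp
  | BAnd bexp bexp

datatype value_oracle = Numer | Denom

text \<open>
  \<open>QValue q x i A\<close> stores in \<open>x[i]\<close> the value of the numerator or denominator on the set whose
  characteristic vector is held in the array \<open>A\<close>; \<open>QIndep x i A\<close> stores \<open>1\<close> in \<open>x[i]\<close> if that
  set is independent, and \<open>0\<close> otherwise.
\<close>

datatype com =
    Skip
  | NAssign vname nexp nexp
  | RAssign vname nexp rexp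
  | QValue value_oracle vname nexp vname
  | QIndep vname nexp vname
  | Seq com com
  | Cond bexp com com
  | While bexp com

record state =
  nats :: "vname \<Rightarrow> nat \<Rightarrow> nat"
  reals :: "vname \<Rightarrow> nat \<Rightarrow> real"

fun nval :: "nexp \<Rightarrow> state \<Rightarrow> nat" where
  "nval (NConst k) s = k"
| "nval (NAt x i) s = nats s x (nval i s)"
| "nval (NAdd a b) s = nval a s + nval b s"
| "nval (NSub a b) s = nval a s - nval b s"

fun rval :: "rexp \<Rightarrow> state \<Rightarrow> real" where
  "rval (RNat a) s = real (nval a s)"
| "rval (RAt x i) s = reals s x (nval i s)"
| "rval (RAdd a b) s = rval a s + rval b s"
| "rval (RSub a b) s = rval a s - rval b s"
| "rval (RMul a b) s = rval a s * rval b s"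
| "rval (RDiv a b) s = rval a s / rval b s"

fun bval :: "bexp \<Rightarrow> state \<Rightarrow> bool" where
  "bval (NLess a b) s \<longleftrightarrow> nval a s < nval b s"
| "bval (RLess a b) s \<longleftrightarrow> rval a s < rval b s"
| "bval (BNot b) s \<longleftrightarrow> \<not> bval b s"
| "bval (BAnd b c) s \<longleftrightarrow> bval b s \<and> bval c s"

definition nupd :: "vname \<Rightarrow> nat \<Rightarrow> nat \<Rightarrow> state \<Rightarrow> state" where
  "nupd x i v s = s\<lparr>nats := (nats s)(x := (nats s x)(i := v))\<rparr>"

definition rupd :: "vname \<Rightarrow> nat \<Rightarrow> real \<Rightarrow> state \<Rightarrow> state" where
  "rupd x i v s = s\<lparr>reals := (reals s)(x := (reals s x)(i := v))\<rparr>"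

definition set_of :: "nat \<Rightarrow> vname \<Rightarrow> state \<Rightarrow> nat set" where
  "set_of n A s = {i. i < n \<and> nats s A i \<noteq> 0}"

text \<open>
  \<open>exec n val indep c s t s'\<close>: on a ground set with elements numbered \<open>0, ..., n - 1\<close> and with
  the given oracles, \<open>c\<close> started in \<open>s\<close> terminates in \<open>s'\<close> after \<open>t\<close> steps. Oracle calls,
  assignments and tests count one step each; as the expressions are fixed by the program,
  charging for their subterms would change the running time by a constant factor only.
\<close>

inductive exec ::
  "nat \<Rightarrow> (value_oracle \<Rightarrow> nat set \<Rightarrow> real) \<Rightarrow> (nat set \<Rightarrow> bool) \<Rightarrow>
   com \<Rightarrow> state \<Rightarrow> nat \<Rightarrow> state \<Rightarrow> bool"
  for n val indep where
  Skip: "exec n val indep Skip s 1 s"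
| NAssign: "exec n val indep (NAssign x i a) s 1 (nupd x (nval i s) (nval a s) s)"
| RAssign: "exec n val indep (RAssign x i a) s 1 (rupd x (nval i s) (rval a s) s)"
| QValue: "exec n val indep (QValue q x i A) s 1 (rupd x (nval i s) (val q (set_of n A s)) s)"
| QIndep: "exec n val indep (QIndep x i A) s 1
             (nupd x (nval i s) (if indep (set_of n A s) then 1 else 0) s)"
| Seq: "exec n val indep c1 s t1 s1 \<Longrightarrow> exec n val indep c2 s1 t2 s2 \<Longrightarrow>
        exec n val indep (Seq c1 c2) s (t1 + t2) s2"
| CondTrue: "bval b s \<Longrightarrow> exec n val indep c1 s t s' \<Longrightarrow>
             exec n val indep (Cond b c1 c2) s (1 + t) s'"
| CondFalse: "\<not> bval b s \<Longrightarrow> exec n val indep c2 s t s' \<Longrightarrow>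
              exec n val indep (Cond b c1 c2) s (1 + t) s'"
| WhileFalse: "\<not> bval b s \<Longrightarrow> exec n val indep (While b c) s 1 s"
| WhileTrue: "bval b s \<Longrightarrow> exec n val indep c s t1 s1 \<Longrightarrow>
              exec n val indep (While b c) s1 t2 s2 \<Longrightarrow>
              exec n val indep (While b c) s (1 + t1 + t2) s2"

lemma exec_deterministic:
  "exec n val indep c s t s1 \<Longrightarrow> exec n val indep c s u s2 \<Longrightarrow> t = u \<and> s1 = s2"
proof (induction arbitrary: u s2 rule: exec.induct)
  case (Seq c1 s t1 s1 c2 t2 s2')
  from Seq.prems show ?case
    by (cases rule: exec.cases) (use Seq.IH in blast)+
next
  case (WhileTrue b s c t1 s1 t2 s2')
  from WhileTrue.prems show ?case
    by (cases rule: exec.cases) (use WhileTrue.IH WhileTrue.hyps in blast)+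
qed (erule exec.cases; fastforce)+

definition init :: "nat \<Rightarrow> state" where
  "init n = nupd ''n'' 0 n \<lparr>nats = (\<lambda>_ _. 0), reals = (\<lambda>_ _. 0)\<rparr>"

text \<open>
  The program sees the ground set \<open>E\<close> only through an arbitrary numbering \<open>en\<close> of its elements:
  it is given \<open>n = card E\<close>, its oracles translate index sets to subsets of \<open>E\<close>, and the answer
  \<open>S\<close> is read off the array \<open>out\<close>.
\<close>

definition computes_in ::
  "com \<Rightarrow> 'a set \<Rightarrow> (nat \<Rightarrow> 'a) \<Rightarrow> ('a set \<Rightarrow> real) \<Rightarrow> ('a set \<Rightarrow> real) \<Rightarrow> 'a set set \<Rightarrow>
   nat \<Rightarrow> 'a set \<Rightarrow> bool" where
  "computes_in c E en f g \<I> t S \<longleftrightarrow>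
     (\<exists>s. exec (card E)
            (\<lambda>q A. case q of Numer \<Rightarrow> f (en ` A) | Denom \<Rightarrow> g (en ` A))
            (\<lambda>A. en ` A \<in> \<I>)
            c (init (card E)) t s
        \<and> S = en ` set_of (card E) ''out'' s)"

end

theory Submission
  imports Defs "HOL-Analysis.Convex" "HOL-Real_Asymp.Real_Asymp"
begin

text \<open>
  Suppose that the optimum \<open>X\<close> is nonempty and let \<open>G\<close> be the largest \<open>g {e}\<close> over \<open>e \<in> X\<close>, so
  that \<open>G \<le> g X\<close>; the program tries all values of \<open>G\<close> and discards the elements with \<open>g {e} > G\<close>.
  On the remaining ones \<open>g\<close> is approximated by \<open>G * sqrt (w S)\<close> for modular weights \<open>w\<close>. They start
  at \<open>1\<close>, and in each of \<open>n\<close> rounds, for \<open>k = 1, 2, 4, \<dots> < 2 * n\<close>, a greedy sequence for \<open>g\<close> on the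
  elements with \<open>w e \<le> k\<close> adds its squared marginals, divided by \<open>G\<^sup>2\<close>, to \<open>w\<close>.
  The squared marginals of one sequence in \<open>S\<close> sum to at most \<open>(g S)\<^sup>2\<close>, which bounds
  \<open>G\<^sup>2 * w S\<close> by \<open>O(n * log n) * (g S)\<^sup>2\<close> if \<open>G \<le> g S\<close>. Conversely, \<open>\<Sum>e. ln (w e)\<close> grows by only
  \<open>O(n * log n)\<close> in total, hence by \<open>O(log n)\<close> in some round, and the weights of such a round, as all later
  ones, satisfy \<open>(g S)\<^sup>2 \<le> O(log n) * G\<^sup>2 * w S\<close>. The two losses multiply to \<open>O(n * (log n)\<^sup>2)\<close>.

  It remains to maximise \<open>f S / sqrt (w S)\<close> over the matroid up to a constant. Let
  \<open>f X / (4 * w X) \<le> l \<le> f X / (2 * w X)\<close>; such an \<open>l\<close> is found among the numbers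
  \<open>f {y} / w y / 2 ^ i\<close> with \<open>y \<in> X\<close>. The matroid greedy algorithm for \<open>f\<close>,
  restricted to elements of marginal at least \<open>l * w e\<close>, yields \<open>S\<close> with \<open>l * w S \<le> f S\<close> and
  \<open>f X \<le> 4 * f S\<close>. The first fact suffices if \<open>w S > w X\<close>, and the second one otherwise.
\<close>

section \<open>Greedy sequences for submodular functions\<close>

locale normalized_submodular =
  fixes V :: "'a set" and h :: "'a set \<Rightarrow> real"
  assumes finite_V: "finite V"
    and empty: "h {} = 0"
    and mono: "A \<subseteq> B \<Longrightarrow> B \<subseteq> V \<Longrightarrow> h A \<le> h B"
    and submod: "A \<subseteq> B \<Longrightarrow> B \<subseteq> V \<Longrightarrow> e \<in> V - B \<Longrightarrow> h (insert e B) - h B \<le> h (insert e A) - h A"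
begin

lemma nonneg: "A \<subseteq> V \<Longrightarrow> 0 \<le> h A"
  using mono[of "{}" A] empty by simp

text \<open>For \<open>e\<close> in \<open>B\<close> the left side is 0 and monotonicity makes the
  right side nonnegative. Sums of marginals may therefore range over elements that are already
  present.\<close>

lemma diminishing:
  assumes "A \<subseteq> B" "B \<subseteq> V" "e \<in> V"
  shows "h (insert e B) - h B \<le> h (insert e A) - h A"
proof (cases "e \<in> B")
  case True
  then have "h A \<le> h (insert e A)" using assms by (intro mono) auto
  then show ?thesis using True by (simp add: insert_absorb)
next
  case False
  then show ?thesis using assms submod by blast
qed

lemma union_le_sum_marginals:
  assumes "A \<subseteq> V" "T \<subseteq> V"
  shows "h (A \<union> T) \<le> h A + (\<Sum>e\<in>T. h (insert e A) - h A)"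
proof -
  have "finite T" using assms finite_V finite_subset by blast
  then show ?thesis using assms(2)
  proof (induction T)
    case (insert e T)
    have "h (insert e (A \<union> T)) - h (A \<union> T) \<le> h (insert e A) - h A"
      using insert assms by (intro diminishing) auto
    then show ?case using insert by simp
  qed simp
qed

lemma le_sum_singletons: "T \<subseteq> V \<Longrightarrow> h T \<le> (\<Sum>e\<in>T. h {e})"
  using union_le_sum_marginals[of "{}" T] empty by simp

lemma subadditive:
  assumes "A \<subseteq> V" "B \<subseteq> V"
  shows "h (A \<union> B) \<le> h A + h B"
proof -
  have "finite B" using assms finite_V finite_subset by blast
  then show ?thesis using assms(2)
  proof (induction B)
    case (insert e B)
    have "h (insert e (A \<union> B)) - h (A \<union> B) \<le> h (insert e B) - h B"
      using insert assms by (intro diminishing) auto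
    then show ?case using insert by simp
  qed (simp add: empty)
qed

end

text \<open>The marginal of \<open>e\<close> over the elements that precede it in \<open>xs\<close>.
  The value 0 off \<open>xs\<close> allows sums over arbitrary sets.\<close>

definition gain :: "('a set \<Rightarrow> real) \<Rightarrow> 'a list \<Rightarrow> 'a \<Rightarrow> real" where
  "gain h xs e = (if e \<in> set xs
     then h (insert e (set (takeWhile (\<lambda>x. x \<noteq> e) xs))) - h (set (takeWhile (\<lambda>x. x \<noteq> e) xs))
     else 0)"

lemma gain_notin [simp]: "e \<notin> set xs \<Longrightarrow> gain h xs e = 0"
  by (simp add: gain_def)

lemma gain_append1: "e \<in> set xs \<Longrightarrow> gain h (xs @ ys) e = gain h xs e"
  by (simp add: gain_def takeWhile_append1)

lemma gain_middle: "e \<notin> set xs \<Longrightarrow> gain h (xs @ e # ys) e = h (insert e (set xs)) - h (set xs)"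
proof -
  assume "e \<notin> set xs"
  then have "takeWhile (\<lambda>x. x \<noteq> e) (xs @ e # ys) = xs" by (induction xs) auto
  then show ?thesis by (simp add: gain_def)
qed

lemma gain_snoc:
  "x \<notin> set xs \<Longrightarrow> gain h (xs @ [x]) =
     (gain h xs)(x := h (insert x (set xs)) - h (set xs))"
proof
  fix e assume "x \<notin> set xs"
  then show "gain h (xs @ [x]) e = ((gain h xs)(x := h (insert x (set xs)) - h (set xs))) e"
    by (cases "e \<in> set xs") (auto simp: gain_append1 gain_middle)
qed

text \<open>A relation rather than a function, because ties may be broken in any way: what holds for
  all paths holds for the one that the program happens to follow.\<close>

inductive greedy_path :: "'a set \<Rightarrow> ('a set \<Rightarrow> real) \<Rightarrow> ('a set \<Rightarrow> 'a \<Rightarrow> bool) \<Rightarrow> 'a list \<Rightarrow> bool"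
  for V h elig where
  Nil: "greedy_path V h elig []"
| snoc: "greedy_path V h elig xs \<Longrightarrow> x \<in> V - set xs \<Longrightarrow> elig (set xs) x \<Longrightarrow>
    (\<And>e. e \<in> V - set xs \<Longrightarrow> elig (set xs) e \<Longrightarrow> h (insert e (set xs)) \<le> h (insert x (set xs))) \<Longrightarrow>
    greedy_path V h elig (xs @ [x])"

definition greedy_run :: "'a set \<Rightarrow> ('a set \<Rightarrow> real) \<Rightarrow> ('a set \<Rightarrow> 'a \<Rightarrow> bool) \<Rightarrow> 'a list \<Rightarrow> bool" where
  "greedy_run V h elig xs \<longleftrightarrow>
     greedy_path V h elig xs \<and> (\<forall>e \<in> V - set xs. \<not> elig (set xs) e)"

lemma greedy_path_subset: "greedy_path V h elig xs \<Longrightarrow> set xs \<subseteq> V \<and> distinct xs"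
  by (induction rule: greedy_path.induct) auto

lemma greedy_path_split:
  assumes "greedy_path V h elig (ys @ x # zs)"
  shows "greedy_path V h elig ys \<and> x \<in> V - set ys \<and> elig (set ys) x \<and>
    (\<forall>e \<in> V - set ys. elig (set ys) e \<longrightarrow> h (insert e (set ys)) \<le> h (insert x (set ys)))"
  using assms
proof (induction zs rule: rev_induct)
  case Nil
  then show ?case by (cases rule: greedy_path.cases) auto
next
  case (snoc z zs)
  from snoc.prems have "greedy_path V h elig (ys @ x # zs)"
    by (cases rule: greedy_path.cases) auto
  then show ?case by (rule snoc.IH)
qed

context normalized_submodular
begin

lemma gain_nonneg:
  assumes "set xs \<subseteq> V"
  shows "0 \<le> gain h xs e"
proof (cases "e \<in> set xs")
  case True
  have "set (takeWhile (\<lambda>x. x \<noteq> e) xs) \<subseteq> set xs" by (meson set_takeWhileD subsetI)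
  with True assms have "h (set (takeWhile (\<lambda>x. x \<noteq> e) xs)) \<le> h (insert e (set (takeWhile (\<lambda>x. x \<noteq> e) xs)))"
    by (intro mono) auto
  then show ?thesis by (simp add: gain_def)
qed simp

lemma gain_le_singleton:
  assumes "set xs \<subseteq> V" "e \<in> V"
  shows "gain h xs e \<le> h {e}"
proof (cases "e \<in> set xs")
  case True
  have "set (takeWhile (\<lambda>x. x \<noteq> e) xs) \<subseteq> set xs" by (meson set_takeWhileD subsetI)
  then have "h (insert e (set (takeWhile (\<lambda>x. x \<noteq> e) xs))) - h (set (takeWhile (\<lambda>x. x \<noteq> e) xs))
    \<le> h (insert e {}) - h {}"
    using assms by (intro diminishing) auto
  then show ?thesis using True by (simp add: gain_def empty)
next
  case False
  then show ?thesis using nonneg[of "{e}"] assms by simp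
qed

lemma sum_gain_eq:
  "set xs \<subseteq> V \<Longrightarrow> distinct xs \<Longrightarrow> (\<Sum>e\<in>set xs. gain h xs e) = h (set xs)"
proof (induction xs rule: rev_induct)
  case (snoc x xs)
  then have "(\<Sum>e\<in>set xs. gain h (xs @ [x]) e) = (\<Sum>e\<in>set xs. gain h xs e)"
    by (intro sum.cong) (auto simp: gain_append1)
  then show ?case using snoc by (simp add: gain_middle)
qed (simp add: empty)

text \<open>By submodularity, the marginal of an element of \<open>S\<close> over a whole prefix is
  at most its marginal over the part of the prefix inside \<open>S\<close>, and the latter marginals
  telescope.\<close>

lemma sum_gain_le:
  assumes "set xs \<subseteq> V" "distinct xs" "S \<subseteq> V"
  shows "(\<Sum>e\<in>S. gain h xs e) \<le> h S"
proof -
  have fin: "finite S" using assms finite_V finite_subset by blast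
  have "(\<Sum>e\<in>S \<inter> set xs. gain h xs e) \<le> h (S \<inter> set xs)"
    using assms(1,2)
  proof (induction xs rule: rev_induct)
    case (snoc x xs)
    have *: "(\<Sum>e\<in>S \<inter> set xs. gain h (xs @ [x]) e) = (\<Sum>e\<in>S \<inter> set xs. gain h xs e)"
      by (intro sum.cong) (auto simp: gain_append1)
    show ?case
    proof (cases "x \<in> S")
      case True
      have "h (insert x (set xs)) - h (set xs) \<le> h (insert x (S \<inter> set xs)) - h (S \<inter> set xs)"
        using snoc.prems by (intro diminishing) auto
      then show ?thesis using snoc True * by (simp add: gain_middle)
    next
      case False
      then show ?thesis using snoc * by simp
    qed
  qed (simp add: empty)
  also have "\<dots> \<le> h S" using assms by (intro mono) auto
  also have "(\<Sum>e\<in>S \<inter> set xs. gain h xs e) = (\<Sum>e\<in>S. gain h xs e)"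
    using fin by (intro sum.mono_neutral_left) auto
  finally show ?thesis .
qed

end

lemma sum_squares_le_square_sum:
  fixes a :: "'a \<Rightarrow> real"
  assumes "\<And>x. x \<in> A \<Longrightarrow> 0 \<le> a x"
  shows "(\<Sum>x\<in>A. (a x)\<^sup>2) \<le> (\<Sum>x\<in>A. a x)\<^sup>2"
proof (cases "finite A")
  case True
  have "(\<Sum>x\<in>A. (a x)\<^sup>2) \<le> (\<Sum>x\<in>A. a x * (\<Sum>x\<in>A. a x))"
    using True assms by (intro sum_mono) (auto simp: power2_eq_square intro!: mult_left_mono member_le_sum)
  then show ?thesis by (simp add: sum_distrib_right power2_eq_square)
qed simp

context normalized_submodular
begin

lemma sum_gain_square_le:
  assumes "set xs \<subseteq> V" "distinct xs" "S \<subseteq> V"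
  shows "(\<Sum>e\<in>S. (gain h xs e)\<^sup>2) \<le> (h S)\<^sup>2"
proof -
  have "(\<Sum>e\<in>S. (gain h xs e)\<^sup>2) \<le> (\<Sum>e\<in>S. gain h xs e)\<^sup>2"
    using assms by (intro sum_squares_le_square_sum gain_nonneg)
  also have "\<dots> \<le> (h S)\<^sup>2"
    using assms by (intro power_mono sum_gain_le sum_nonneg gain_nonneg) auto
  finally show ?thesis .
qed

text \<open>With \<open>ys\<close> the first \<open>card T\<close> picks,
  \<open>h T <= 2 * h (set ys)\<close> as for greedy under a cardinality constraint: the marginal of
  the next pick is at most the gain of each pick in \<open>ys\<close> and at least the marginal of
  each element of \<open>T\<close> over \<open>ys\<close>. Cauchy-Schwarz for the
  \<open>card T\<close> gains that sum to \<open>h (set ys)\<close> does the rest.\<close>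

lemma square_le_card_sum_gain_square:
  assumes run: "greedy_run V h (\<lambda>_ e. e \<in> U) xs" and U: "U \<subseteq> V" and T: "T \<subseteq> U"
  shows "(h T)\<^sup>2 \<le> 4 * card T * (\<Sum>e\<in>V. (gain h xs e)\<^sup>2)"
proof -
  have path: "greedy_path V h (\<lambda>_ e. e \<in> U) xs" using run by (simp add: greedy_run_def)
  have sub: "set xs \<subseteq> V" "distinct xs" using greedy_path_subset[OF path] by auto
  have UV: "U \<subseteq> set xs" using run U by (auto simp: greedy_run_def)
  have TV: "T \<subseteq> V" using T U by auto
  have finT: "finite T" using TV finite_V finite_subset by blast
  define k where "k = card T"
  define ys where "ys = take k xs"
  have ys: "set ys \<subseteq> V" "distinct ys"
    using sub by (auto simp: ys_def dest: in_set_takeD)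
  have "card T \<le> card (set xs)" using T UV by (intro card_mono) auto
  then have "k \<le> length xs" using sub by (simp add: k_def distinct_card)
  then have card_ys: "card (set ys) = k" using ys by (simp add: distinct_card) (simp add: ys_def)
  have gys: "gain h ys e = gain h xs e" if "e \<in> set ys" for e
    using that gain_append1[of e ys h "drop k xs"] by (simp add: ys_def)
  have hT: "h T \<le> 2 * h (set ys)"
  proof (cases "k < length xs")
    case False
    then have "ys = xs" by (simp add: ys_def)
    then have "h T \<le> h (set ys)" using T UV ys by (intro mono) auto
    then show ?thesis using nonneg[OF ys(1)] by simp
  next
    case True
    define x where "x = xs ! k"
    have split: "xs = ys @ x # drop (Suc k) xs" 
      unfolding ys_def x_def using True by (rule id_take_nth_drop)
    with path have p: "greedy_path V h (\<lambda>_ e. e \<in> U) (ys @ x # drop (Suc k) xs)" by simp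
    have x: "x \<in> V" "x \<notin> set ys" "x \<in> U"
      and best: "\<And>e. e \<in> V - set ys \<Longrightarrow> e \<in> U \<Longrightarrow> h (insert e (set ys)) \<le> h (insert x (set ys))"
      using greedy_path_split[OF p] by auto
    define a where "a = h (insert x (set ys)) - h (set ys)"
    have a0: "0 \<le> a" using mono[of "set ys" "insert x (set ys)"] ys x by (auto simp: a_def)
    have "a \<le> gain h ys e" if e: "e \<in> set ys" for e
    proof -
      obtain as bs where s: "ys = as @ e # bs" using e by (meson split_list)
      have ne: "e \<notin> set as" using ys s by auto
      \<comment> \<open>When \<open>e\<close> was picked, \<open>x\<close> was available too and had
        no larger marginal. By submodularity the later marginal \<open>a\<close> of \<open>x\<close>
        is smaller still.\<close>
      have "greedy_path V h (\<lambda>_ e. e \<in> U) (as @ e # (bs @ x # drop (Suc k) xs))"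
        using p s by simp
      from greedy_path_split[OF this] x s
      have 1: "h (insert x (set as)) \<le> h (insert e (set as))" by auto
      have "a \<le> h (insert x (set as)) - h (set as)"
        unfolding a_def using s ys x by (intro diminishing) auto
      with 1 show ?thesis unfolding s gain_middle[OF ne] by simp
    qed
    then have "(\<Sum>e\<in>set ys. a) \<le> (\<Sum>e\<in>set ys. gain h ys e)" by (intro sum_mono)
    then have ka: "k * a \<le> h (set ys)" using sum_gain_eq[OF ys] card_ys by simp
    have "h T \<le> h (set ys \<union> T)" using ys TV by (intro mono) auto
    also have "\<dots> \<le> h (set ys) + (\<Sum>e\<in>T. h (insert e (set ys)) - h (set ys))"
      using ys TV by (intro union_le_sum_marginals)
    also have "(\<Sum>e\<in>T. h (insert e (set ys)) - h (set ys)) \<le> (\<Sum>e\<in>T. a)"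
    proof (rule sum_mono)
      fix e assume "e \<in> T"
      then show "h (insert e (set ys)) - h (set ys) \<le> a"
        using best[of e] a0 T TV by (cases "e \<in> set ys") (auto simp: a_def insert_absorb)
    qed
    also have "\<dots> = k * a" by (simp add: k_def)
    finally show ?thesis using ka by simp
  qed
  have "(h (set ys))\<^sup>2 = (\<Sum>e\<in>set ys. 1 * gain h xs e)\<^sup>2"
    using sum_gain_eq[OF ys] gys by simp
  also have "\<dots> \<le> (\<Sum>e\<in>set ys. 1\<^sup>2) * (\<Sum>e\<in>set ys. (gain h xs e)\<^sup>2)"
    by (rule Cauchy_Schwarz_ineq_sum)
  also have "\<dots> \<le> k * (\<Sum>e\<in>V. (gain h xs e)\<^sup>2)"
    using ys finite_V by (auto simp: card_ys intro!: mult_left_mono sum_mono2)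
  finally have "(h (set ys))\<^sup>2 \<le> k * (\<Sum>e\<in>V. (gain h xs e)\<^sup>2)" .
  moreover have "(h T)\<^sup>2 \<le> (2 * h (set ys))\<^sup>2"
    using hT nonneg[OF TV] by (intro power_mono)
  ultimately show ?thesis by (simp add: k_def power_mult_distrib)
qed

end

section \<open>Greedy under a matroid constraint and a density threshold\<close>

locale matroid_normalized_submodular = normalized_submodular V h + matroid V \<I>
  for V :: "'a set" and h \<I>
begin

text \<open>Summing the density tests of all picks gives the third claim. For the fourth, the
  elements of \<open>X\<close> outside the run are split by their final marginals: those that still
  reach the threshold (\<open>M\<close>) are charged to picks, and those below it (\<open>D\<close>)
  contribute at most \<open>l * sum w X\<close> together.\<close>

lemma density_greedy:
  fixes w :: "'a \<Rightarrow> real"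
  assumes run: "greedy_run V h (\<lambda>S e. e \<in> U \<and> insert e S \<in> \<I> \<and> l * w e \<le> h (insert e S) - h S) xs"
    and l: "0 \<le> l" and w: "\<And>e. e \<in> V \<Longrightarrow> 0 \<le> w e"
  shows "set xs \<in> \<I>" "set xs \<subseteq> U" "l * sum w (set xs) \<le> h (set xs)"
    "\<And>X. X \<in> \<I> \<Longrightarrow> X \<subseteq> U \<Longrightarrow> h X \<le> 2 * h (set xs) + l * sum w X"
proof -
  let ?el = "\<lambda>S e. e \<in> U \<and> insert e S \<in> \<I> \<and> l * w e \<le> h (insert e S) - h S"
  have path: "greedy_path V h ?el xs" 
    and stuck: "\<And>e. e \<in> V - set xs \<Longrightarrow> \<not> ?el (set xs) e" using run by (auto simp: greedy_run_def)
  have sub: "set xs \<subseteq> V" "distinct xs" using greedy_path_subset[OF path] by auto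
  have "set ys \<in> \<I> \<and> set ys \<subseteq> U \<and> l * sum w (set ys) \<le> h (set ys)" if "greedy_path V h ?el ys" for ys
    using that by (induction rule: greedy_path.induct) (auto simp: empty_indep empty algebra_simps)
  from this[OF path] show indep: "set xs \<in> \<I>" and "set xs \<subseteq> U" "l * sum w (set xs) \<le> h (set xs)" by auto
  fix X assume X: "X \<in> \<I>" "X \<subseteq> U"
  have OV: "X \<subseteq> V" using X indep_subset_ground by auto
  have finO: "finite X" using OV finite_V finite_subset by blast
  let ?m = "\<lambda>e. h (insert e (set xs)) - h (set xs)"
  define M where "M = {e \<in> X - set xs. l * w e \<le> ?m e}"
  define D where "D = {e \<in> X - set xs. \<not> l * w e \<le> ?m e}"
  \<comment> \<open>Exchange with the first \<open>card N - 1\<close> picks yields an element of \<open>N\<close> that was feasible when the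
    last of the first \<open>card N\<close> picks was made; it is charged to that pick.\<close>
  have "sum ?m N \<le> h (set (take (card N) xs))" if "N \<subseteq> M" "card N \<le> length xs" for N
    using that
  proof (induction "card N" arbitrary: N)
    case 0
    moreover have "finite N" using 0 finO finite_subset[of N X] by (auto simp: M_def)
    ultimately have "N = {}" by simp
    then show ?case by (simp add: empty)
  next
    case (Suc k)
    define ys where "ys = take k xs"
    define x where "x = xs ! k"
    have k: "k < length xs" using Suc by simp
    have split: "xs = ys @ x # drop (Suc k) xs" 
      unfolding ys_def x_def using k by (rule id_take_nth_drop)
    have p: "greedy_path V h ?el (ys @ x # drop (Suc k) xs)" using path split by simp
    note ps = greedy_path_split[OF p]
    have pys: "greedy_path V h ?el ys" using ps by blast
    have ysI: "set ys \<in> \<I>" 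
      using pys by (cases rule: greedy_path.cases) (auto simp: empty_indep)
    have ysV: "set ys \<subseteq> V" "distinct ys" using greedy_path_subset[OF pys] by auto
    have ysxs: "set ys \<subseteq> set xs" by (simp add: ys_def set_take_subset)
    have "card (set ys) = k" using ysV k by (simp add: distinct_card) (simp add: ys_def)
    moreover have NI: "N \<in> \<I>" using Suc.prems X indep_subset[of N X] by (auto simp: M_def)
    ultimately obtain e where e: "e \<in> N" "e \<notin> set ys" "insert e (set ys) \<in> \<I>"
      using exchange[OF ysI NI] Suc.hyps by auto
    have eM: "e \<in> V" "e \<notin> set xs" "e \<in> U" "l * w e \<le> ?m e" 
      using e Suc.prems OV X by (auto simp: M_def)
    have me: "?m e \<le> h (insert e (set ys)) - h (set ys)"
      using ysxs sub eM by (intro diminishing) auto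
    \<comment> \<open>The marginal of \<open>e\<close> over \<open>ys\<close> is at least the one
      over the whole run, so \<open>e\<close> also passed the density test at the time when
      \<open>x\<close> was preferred.\<close>
    then have "h (insert e (set ys)) \<le> h (insert x (set ys))"
      using ps e eM by force
    with me have me': "?m e \<le> h (insert x (set ys)) - h (set ys)" by simp
    have fN: "finite N" using Suc(2) card.infinite by fastforce
    have "sum ?m (N - {e}) \<le> h (set (take (card (N - {e})) xs))"
      using Suc e fN by (intro Suc.hyps(1)) (auto simp: card_Diff_singleton)
    then have "sum ?m (N - {e}) \<le> h (set ys)" using Suc(2)[symmetric] e by (simp add: ys_def card_Diff_singleton)
    moreover have "sum ?m N = ?m e + sum ?m (N - {e})" using fN e by (simp add: sum.remove)
    moreover have "take (card N) xs = ys @ [x]" using Suc(2)[symmetric] k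
      by (simp add: ys_def x_def take_Suc_conv_app_nth)
    ultimately show ?case using me' by simp
  qed
  note cover = this
  \<comment> \<open>Otherwise exchange against the whole run yields an element of \<open>M\<close>
    that is still eligible when the run has stopped.\<close>
  have "card M \<le> length xs"
  proof (rule ccontr)
    assume "\<not> card M \<le> length xs"
    then have "card (set xs) < card M" using sub by (simp add: distinct_card)
    moreover have "M \<in> \<I>" using X indep_subset[of M X] by (auto simp: M_def)
    ultimately obtain e where "e \<in> M - set xs" "insert e (set xs) \<in> \<I>" using exchange[OF indep] by blast
    then show False using stuck[of e] X OV by (auto simp: M_def)
  qed
  from cover[OF _ this] have "sum ?m M \<le> h (set (take (card M) xs))" by simp
  also have "\<dots> \<le> h (set xs)" using sub by (intro mono) (auto simp: set_take_subset)
  finally have sM: "sum ?m M \<le> h (set xs)" .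
  have "sum ?m D \<le> (\<Sum>e\<in>D. l * w e)" by (intro sum_mono) (auto simp: D_def)
  also have "\<dots> \<le> (\<Sum>e\<in>X. l * w e)" using OV finO l w by (intro sum_mono2) (auto simp: D_def)
  finally have sD: "sum ?m D \<le> l * sum w X" by (simp add: sum_distrib_left)
  have "h X \<le> h (set xs \<union> (X - set xs))" using OV sub by (intro mono) auto
  also have "\<dots> \<le> h (set xs) + sum ?m (X - set xs)"
    using OV sub by (intro union_le_sum_marginals) auto
  also have "X - set xs = M \<union> D" by (auto simp: M_def D_def)
  also have "sum ?m (M \<union> D) = sum ?m M + sum ?m D"
    using finO by (intro sum.union_disjoint) (auto simp: M_def D_def)
  finally show "h X \<le> 2 * h (set xs) + l * sum w X" using sM sD by simp
qed

end

section \<open>Modular weights for a submodular function\<close>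

text \<open>The number of values \<open>k = 1, 2, 4, ...\<close> below \<open>2 * n\<close>, hence
  the number of passes in one round.\<close>

definition scales :: "nat \<Rightarrow> nat" where
  "scales n = (LEAST j. 2 * n \<le> 2 ^ j)"

lemma scales_ge: "2 * n \<le> 2 ^ scales n"
proof -
  have "2 * n \<le> 2 ^ (Suc n)" using less_exp[of n] by simp
  then show ?thesis unfolding scales_def by (rule LeastI)
qed

lemma less_scales_iff: "j < scales n \<longleftrightarrow> 2 ^ j < 2 * n"
proof
  assume "j < scales n"
  then show "2 ^ j < 2 * n" unfolding scales_def using not_less_Least not_le by blast
next
  assume a: "2 ^ j < 2 * n"
  show "j < scales n"
  proof (rule ccontr)
    assume "\<not> j < scales n"
    then have "(2::nat) ^ scales n \<le> 2 ^ j" by (intro power_increasing) auto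
    then show False using a scales_ge[of n] by linarith
  qed
qed

lemma scales_le: "scales n \<le> 2 * n"
proof (cases "scales n")
  case (Suc j)
  then have "2 ^ j < 2 * n" using less_scales_iff[of j n] by simp
  then show ?thesis using Suc less_exp[of j] by linarith
qed simp

lemma scales_le_log:
  assumes "0 < n"
  shows "real (scales n) \<le> 2 + log 2 n"
proof (cases "scales n")
  case 0
  then show ?thesis using assms zero_le_log_cancel_iff[of 2 "real n"] by (simp add: add_nonneg_nonneg)
next
  case (Suc j)
  then have "2 ^ j < 2 * n" using less_scales_iff[of j n] by simp
  then have "real (2 ^ j) \<le> real (2 * n)" by linarith
  then have "2 powr real j \<le> 2 * real n" by (simp add: powr_realpow)
  then have "real j \<le> log 2 (2 * real n)" using assms by (simp add: le_log_iff)
  then show ?thesis using Suc assms by (simp add: log_mult)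
qed

text \<open>For \<open>G = 0\<close> the quotient is 0 by convention, so the weights do not
  change.\<close>

definition reweight :: "real \<Rightarrow> ('a set \<Rightarrow> real) \<Rightarrow> 'a list \<Rightarrow> ('a \<Rightarrow> real) \<Rightarrow> 'a \<Rightarrow> real" where
  "reweight G h xs w = (\<lambda>e. w e + (gain h xs e / G)\<^sup>2)"

definition light :: "real \<Rightarrow> ('a set \<Rightarrow> real) \<Rightarrow> ('a \<Rightarrow> real) \<Rightarrow> real \<Rightarrow> 'a \<Rightarrow> bool" where
  "light G h w k e \<longleftrightarrow> h {e} \<le> G \<and> w e \<le> k"

text \<open>The pass with number \<open>j\<close>, counted from 0, has the weight threshold
  \<open>2 ^ j\<close>. As with \<open>rounds\<close> below, a relation is used because greedy runs
  are not unique.\<close>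

inductive passes :: "'a set \<Rightarrow> ('a set \<Rightarrow> real) \<Rightarrow> real \<Rightarrow> nat \<Rightarrow> ('a \<Rightarrow> real) \<Rightarrow> ('a \<Rightarrow> real) \<Rightarrow> bool"
  for V h G where
  zero: "passes V h G 0 w w"
| Suc: "passes V h G j w w1 \<Longrightarrow> greedy_run V h (\<lambda>_. light G h w1 (2 ^ j)) xs \<Longrightarrow>
    passes V h G (Suc j) w (reweight G h xs w1)"

inductive rounds :: "'a set \<Rightarrow> ('a set \<Rightarrow> real) \<Rightarrow> real \<Rightarrow> nat \<Rightarrow> nat \<Rightarrow> ('a \<Rightarrow> real) \<Rightarrow> bool"
  for V h G J where
  zero: "rounds V h G J 0 (\<lambda>_. 1)"
| Suc: "rounds V h G J t w \<Longrightarrow> passes V h G J w w1 \<Longrightarrow> rounds V h G J (Suc t) w1"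

text \<open>Cauchy-Schwarz in two coordinates. Together with subadditivity it merges the bounds for
  two disjoint parts of a set without losing a constant factor.\<close>

lemma add_square_le:
  fixes a b A B x y :: real
  assumes "a\<^sup>2 \<le> A * x" "b\<^sup>2 \<le> B * y" "0 \<le> A" "0 \<le> B" "0 \<le> x" "0 \<le> y"
  shows "(a + b)\<^sup>2 \<le> (A + B) * (x + y)"
proof -
  have "\<bar>a\<bar> \<le> sqrt (A * x)" "\<bar>b\<bar> \<le> sqrt (B * y)"
    using assms by (simp_all add: real_le_rsqrt)
  then have "\<bar>a\<bar> * \<bar>b\<bar> \<le> sqrt (A * x) * sqrt (B * y)" by (intro mult_mono) (use assms in auto)
  also have "\<dots> = sqrt (A * y) * sqrt (B * x)" by (simp add: real_sqrt_mult)
  finally have "2 * (a * b) \<le> 2 * (sqrt (A * y) * sqrt (B * x))"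
    using abs_mult[of a b] abs_ge_self[of "a * b"] by linarith
  also have "\<dots> \<le> (sqrt (A * y))\<^sup>2 + (sqrt (B * x))\<^sup>2"
    using sum_squares_bound[of "sqrt (A * y)" "sqrt (B * x)"] by (simp add: algebra_simps)
  also have "\<dots> = A * y + B * x" using assms by simp
  finally show ?thesis using assms(1,2) by (simp add: power2_sum algebra_simps)
qed

lemma half_le_ln_add_one: 
  fixes x :: real
  assumes "0 \<le> x" "x \<le> 1"
  shows "x / 2 \<le> ln (1 + x)"
proof -
  have "ln (1 / (1 + x)) \<le> 1 / (1 + x) - 1" using assms by (intro ln_le_minus_one) auto
  then have "x / (1 + x) \<le> ln (1 + x)" using assms by (simp add: ln_div field_simps)
  moreover have "x / 2 \<le> x / (1 + x)" using assms by (intro divide_left_mono) auto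
  ultimately show ?thesis by linarith
qed

section \<open>Upper and lower bounds on the weights\<close>

context normalized_submodular
begin

lemma reweight_ge: "w e \<le> reweight G h xs w e"
  by (simp add: reweight_def)

lemma passes_mono: "passes V h G j w w' \<Longrightarrow> w e \<le> w' e"
  by (induction rule: passes.induct) (auto intro: order_trans reweight_ge)

lemma rounds_ge_1: "rounds V h G J t w \<Longrightarrow> 1 \<le> w e"
proof (induction rule: rounds.induct)
  case (Suc t w w1)
  then show ?case using passes_mono[of G J w w1 e] by linarith
qed simp

lemma
  assumes run: "greedy_run V h (\<lambda>_. light G h w k) xs"
  shows run_sub: "set xs \<subseteq> V" "distinct xs" "\<And>e. e \<in> set xs \<Longrightarrow> light G h w k e"
proof -
  have path: "greedy_path V h (\<lambda>_. light G h w k) xs" using run by (simp add: greedy_run_def)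
  show "set xs \<subseteq> V" "distinct xs" using greedy_path_subset[OF path] by auto
  show "light G h w k e" if "e \<in> set xs" for e
    using path that by (induction rule: greedy_path.induct) auto
qed

lemma gain_le_bound:
  assumes run: "greedy_run V h (\<lambda>_. light G h w k) xs" and "e \<in> V" and "0 \<le> G"
  shows "gain h xs e \<le> G"
proof (cases "e \<in> set xs")
  case True
  then show ?thesis
    using run_sub[OF run] gain_le_singleton[of xs e] assms by (force simp: light_def)
qed (use assms in simp)

text \<open>A gain never exceeds the singleton value, which is at most \<open>G\<close> for the
  elements of such a run.\<close>

lemma gain_div_square_le_1:
  assumes run: "greedy_run V h (\<lambda>_. light G h w k) xs" and "e \<in> V" and "0 \<le> G"
  shows "(gain h xs e / G)\<^sup>2 \<le> 1"
proof -
  have "\<bar>gain h xs e / G\<bar> \<le> 1"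
    using gain_le_bound[OF assms] gain_nonneg[of xs e] run_sub[OF run] assms
    by (cases "G = 0") (auto simp: divide_le_eq_1)
  then show ?thesis using abs_square_le_1 by blast
qed

text \<open>Each pass adds squared gains divided by \<open>G\<^sup>2\<close>; these gains have
  squares summing to at most \<open>(h S)\<^sup>2\<close> on \<open>S\<close>. Stating the first
  bound with the factor \<open>G\<^sup>2\<close> keeps it meaningful for
  \<open>G = 0\<close>.\<close>

lemma passes_upper:
  fixes G :: real
  assumes "passes V h G j w w'" "0 \<le> G"
  shows "S \<subseteq> V \<Longrightarrow> sum w' S * G\<^sup>2 \<le> sum w S * G\<^sup>2 + j * (h S)\<^sup>2"
    and "e \<in> V \<Longrightarrow> w' e \<le> w e + j"
  using assms
proof (induction rule: passes.induct)
  case (Suc j w w1 xs)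
  note sub = run_sub[OF Suc.hyps(2)]
  {
    case 1
    have "(gain h xs e / G)\<^sup>2 * G\<^sup>2 \<le> (gain h xs e)\<^sup>2" for e by (cases "G = 0") (auto simp: power_divide)
    then have "(\<Sum>e\<in>S. (gain h xs e / G)\<^sup>2 * G\<^sup>2) \<le> (\<Sum>e\<in>S. (gain h xs e)\<^sup>2)"
      by (intro sum_mono)
    also have "\<dots> \<le> (h S)\<^sup>2" using sub 1 by (intro sum_gain_square_le)
    finally have "(\<Sum>e\<in>S. (gain h xs e / G)\<^sup>2 * G\<^sup>2) \<le> (h S)\<^sup>2" .
    moreover have "sum (reweight G h xs w1) S * G\<^sup>2 = sum w1 S * G\<^sup>2 + (\<Sum>e\<in>S. (gain h xs e / G)\<^sup>2 * G\<^sup>2)"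
      by (simp only: reweight_def sum.distrib distrib_right sum_distrib_right)
    moreover have "sum w1 S * G\<^sup>2 \<le> sum w S * G\<^sup>2 + j * (h S)\<^sup>2"
      using 1 by (intro Suc.IH(1))
    ultimately show ?case by (simp add: distrib_right)
  next
    case 2
    show ?case using Suc.IH(2) 2 gain_div_square_le_1[OF Suc.hyps(2), of e]
      by (simp add: reweight_def)
  }
qed auto

lemma rounds_upper:
  fixes G :: real
  assumes "rounds V h G J t w" "0 \<le> G"
  shows "S \<subseteq> V \<Longrightarrow> sum w S * G\<^sup>2 \<le> card S * G\<^sup>2 + t * J * (h S)\<^sup>2"
    and "e \<in> V \<Longrightarrow> w e \<le> 1 + t * J"
  using assms
proof (induction rule: rounds.induct)
  case (Suc t w w1)
  {
    case 1
    then show ?case using Suc.IH(1) passes_upper(1)[OF Suc.hyps(2) 1(2), of S] by (simp add: algebra_simps)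
  next
    case 2
    then show ?case using Suc.IH(2) passes_upper(2)[OF Suc.hyps(2) 2(2), of e] by (simp add: algebra_simps)
  }
qed auto

definition potential :: "('a \<Rightarrow> real) \<Rightarrow> real" where
  "potential w = (\<Sum>e\<in>V. ln (w e))"

text \<open>A picked element has \<open>w e <= k\<close> and receives an increment \<open>x\<close>
  with \<open>x <= 1 <= w e\<close>, so \<open>ln (w e)\<close> grows by at least
  \<open>x / (2 * w e)\<close>, which is at least \<open>x / (2 * k)\<close>.\<close>

lemma potential_pass:
  assumes run: "greedy_run V h (\<lambda>_. light G h w k) xs" and "0 < G" and w: "\<And>e. 1 \<le> w e"
  shows "(\<Sum>e\<in>V. (gain h xs e)\<^sup>2) \<le> 2 * k * G\<^sup>2 * (potential (reweight G h xs w) - potential w)"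
proof -
  have "(gain h xs e)\<^sup>2 \<le> 2 * k * G\<^sup>2 * (ln (reweight G h xs w e) - ln (w e))" if e: "e \<in> V" for e
  proof (cases "e \<in> set xs")
    case True
    let ?x = "(gain h xs e / G)\<^sup>2"
    have wk: "w e \<le> k" using run_sub[OF run] True by (auto simp: light_def)
    have w0: "0 < w e" using w[of e] by simp
    have x1: "?x \<le> 1" using run e assms by (intro gain_div_square_le_1) auto
    have "?x / k \<le> ?x / w e" using wk w0 by (intro divide_left_mono) auto
    then have "?x / k / 2 \<le> ?x / w e / 2" by simp
    also have "\<dots> \<le> ln (1 + ?x / w e)"
      using x1 w0 w[of e] by (intro half_le_ln_add_one) (auto simp: divide_le_eq_1)
    also have "1 + ?x / w e = reweight G h xs w e / w e"
      using w0 by (simp add: reweight_def field_simps)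
    also have "ln \<dots> = ln (reweight G h xs w e) - ln (w e)"
      using w0 reweight_ge[of w e G xs] by (intro ln_divide_pos) auto
    finally show ?thesis using assms(2) wk w0 by (simp add: power_divide field_simps)
  qed (simp add: reweight_def)
  then have "(\<Sum>e\<in>V. (gain h xs e)\<^sup>2) \<le> (\<Sum>e\<in>V. 2 * k * G\<^sup>2 * (ln (reweight G h xs w e) - ln (w e)))"
    by (intro sum_mono)
  then show ?thesis by (simp only: potential_def sum_subtractf[symmetric] sum_distrib_left)
qed

lemma potential_mono:
  assumes "\<And>e. 1 \<le> w e" "\<And>e. w e \<le> w' e"
  shows "potential w \<le> potential w'"
  unfolding potential_def
proof (rule sum_mono)
  fix e
  show "ln (w e) \<le> ln (w' e)" using assms[of e] by (intro ln_mono) linarith+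
qed

text \<open>
  The elements in the weight class \<open>2 ^ (j - 1) < w \<le> 2 ^ j\<close> are untouched by the passes before
  pass \<open>j\<close>, which is the one that pays for them.
\<close>

lemma passes_lower:
  assumes "passes V h G j w w'" "0 < G" "\<And>e. 1 \<le> w e"
  shows "S \<subseteq> V \<Longrightarrow> (\<And>e. e \<in> S \<Longrightarrow> h {e} \<le> G \<and> 2 * w e \<le> 2 ^ j) \<Longrightarrow>
      (h S)\<^sup>2 \<le> (G\<^sup>2 * sum w S) * (16 * (potential w' - potential w))"
    and "2 ^ j < 2 * w e \<Longrightarrow> w' e = w e"
  using assms
proof (induction arbitrary: S e rule: passes.induct)
  case (zero w)
  {
    case 1
    have "e \<notin> S" for e using 1(2)[of e] 1(4)[of e] by auto
    then have "S = {}" by blast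
    then show ?case by (simp add: empty)
  next
    case 2
    show ?case by simp
  }
next
  case (Suc j w w1 xs)
  let ?w2 = "reweight G h xs w1"
  {
    case 1
    have w1: "1 \<le> w1 e" for e using 1(4)[of e] passes_mono[OF Suc.hyps(1), of e] by linarith
    \<comment> \<open>\<open>S1\<close> is left to the earlier passes by induction;
      \<open>S2\<close> is the weight class of the current pass.\<close>
    define S1 where "S1 = {e \<in> S. 2 * w e \<le> 2 ^ j}"
    define S2 where "S2 = {e \<in> S. 2 ^ j < 2 * w e}"
    have S: "S = S1 \<union> S2" "S1 \<inter> S2 = {}" by (auto simp: S1_def S2_def)
    have SV: "S1 \<subseteq> V" "S2 \<subseteq> V" using S 1 by auto
    have fin: "finite S1" "finite S2" using SV finite_V finite_subset by blast+
    have h1: "(h S1)\<^sup>2 \<le> (G\<^sup>2 * sum w S1) * (16 * (potential w1 - potential w))"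
      using 1 SV by (intro Suc.IH(1)) (auto simp: S1_def)
    have "(h S2)\<^sup>2 \<le> 4 * card S2 * (\<Sum>e\<in>V. (gain h xs e)\<^sup>2)"
    proof (rule square_le_card_sum_gain_square)
      show "greedy_run V h (\<lambda>_ e. e \<in> {e \<in> V. light G h w1 (2 ^ j) e}) xs"
      proof -
        have "greedy_path V h (\<lambda>_ e. e \<in> {e \<in> V. light G h w1 (2 ^ j) e}) ys"
          if "greedy_path V h (\<lambda>_. light G h w1 (2 ^ j)) ys" for ys
          using that by (induction rule: greedy_path.induct) (auto intro: greedy_path.intros)
        then show ?thesis using Suc.hyps(2) by (auto simp: greedy_run_def)
      qed
      show "S2 \<subseteq> {e \<in> V. light G h w1 (2 ^ j) e}"
      proof
        fix e assume e: "e \<in> S2"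
        then have "w1 e = w e" using 1 by (intro Suc.IH(2)) (auto simp: S2_def)
        then show "e \<in> {e \<in> V. light G h w1 (2 ^ j) e}"
          using 1(2)[of e] e SV S by (auto simp: light_def)
      qed
    qed auto
    also have "\<dots> \<le> 4 * card S2 * (2 * 2 ^ j * G\<^sup>2 * (potential ?w2 - potential w1))"
      using potential_pass[OF Suc.hyps(2)] 1 w1 by (intro mult_left_mono) auto
    also have "\<dots> = (card S2 * 2 ^ j) * (8 * G\<^sup>2 * (potential ?w2 - potential w1))"
      by simp
    \<comment> \<open>Elements of \<open>S2\<close> weigh more than half of the threshold, so their
      number times \<open>2 ^ j\<close> is paid by their weight.\<close>
    also have "\<dots> \<le> (2 * sum w S2) * (8 * G\<^sup>2 * (potential ?w2 - potential w1))"
    proof (rule mult_right_mono)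
      have "(\<Sum>e\<in>S2. 2 ^ j) \<le> (\<Sum>e\<in>S2. 2 * w e)" by (intro sum_mono) (auto simp: S2_def)
      then show "card S2 * 2 ^ j \<le> 2 * sum w S2" by (simp add: sum_distrib_left)
      show "0 \<le> 8 * G\<^sup>2 * (potential ?w2 - potential w1)"
        using potential_mono[of w1 ?w2] w1 reweight_ge by simp
    qed
    finally have h2: "(h S2)\<^sup>2 \<le> (G\<^sup>2 * sum w S2) * (16 * (potential ?w2 - potential w1))"
      by (simp add: algebra_simps)
    have w0: "0 \<le> w e" for e using 1(4)[of e] by simp
    \<comment> \<open>The potential increases of the earlier passes and of this one telescope, so
      the splitting of \<open>S\<close> costs nothing.\<close>
    have "(h S1 + h S2)\<^sup>2 \<le> (G\<^sup>2 * sum w S1 + G\<^sup>2 * sum w S2) *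
       (16 * (potential w1 - potential w) + 16 * (potential ?w2 - potential w1))"
    proof (rule add_square_le[OF h1 h2])
      show "0 \<le> 16 * (potential w1 - potential w)"
        using potential_mono[of w w1] 1(4) passes_mono[OF Suc.hyps(1)] by simp
      show "0 \<le> 16 * (potential ?w2 - potential w1)"
        using potential_mono[of w1 ?w2] w1 reweight_ge by simp
    qed (auto intro!: mult_nonneg_nonneg sum_nonneg w0)
    also have "\<dots> = (G\<^sup>2 * sum w S) * (16 * (potential ?w2 - potential w))"
      using fin S by (simp add: sum.union_disjoint algebra_simps)
    finally show ?case
      using power_mono[OF subadditive[OF SV] nonneg, of 2] SV S by simp
  next
    case 2
    have "2 ^ j < 2 * w e" using 2(1) zero_less_power[of "2::real" j] unfolding power_Suc by linarith
    then have "w1 e = w e" using 2 by (intro Suc.IH(2)) auto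
    moreover have "e \<notin> set xs" 
    proof
      assume "e \<in> set xs"
      then have "light G h w1 (2 ^ j) e" using run_sub[OF Suc.hyps(2)] by blast
      then show False using 2 calculation by (simp add: light_def)
    qed
    ultimately show ?case by (simp add: reweight_def)
  }
qed

text \<open>The summand 1 pays for the elements too heavy for every class: each weighs more than
  \<open>card V\<close>, so a set \<open>S2\<close> of them has weight at least
  \<open>(card S2)\<^sup>2\<close>, while \<open>h S2 <= card S2 * G\<close>.\<close>

lemma round_lower:
  assumes p: "passes V h G J w w'" and G: "0 < G" and w: "\<And>e. 1 \<le> w e"
    and J: "2 * card V \<le> (2::nat) ^ J" and S: "S \<subseteq> V" "\<And>e. e \<in> S \<Longrightarrow> h {e} \<le> G"
  shows "(h S)\<^sup>2 \<le> (G\<^sup>2 * sum w S) * (1 + 16 * (potential w' - potential w))"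
proof -
  define S1 where "S1 = {e \<in> S. 2 * w e \<le> 2 ^ J}"
  define S2 where "S2 = {e \<in> S. 2 ^ J < 2 * w e}"
  have SU: "S = S1 \<union> S2" "S1 \<inter> S2 = {}" by (auto simp: S1_def S2_def)
  have SV: "S1 \<subseteq> V" "S2 \<subseteq> V" using SU S by auto
  have fin: "finite S1" "finite S2" using SV finite_V finite_subset by blast+
  have w0: "0 \<le> w e" for e using w[of e] by simp
  have h1: "(h S1)\<^sup>2 \<le> (G\<^sup>2 * sum w S1) * (16 * (potential w' - potential w))"
    using p G w SV S by (intro passes_lower(1)) (auto simp: S1_def)
  have "h S2 \<le> (\<Sum>e\<in>S2. h {e})" using SV by (intro le_sum_singletons)
  also have "\<dots> \<le> (\<Sum>e\<in>S2. G)" using S SU by (intro sum_mono) auto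
  finally have "h S2 \<le> card S2 * G" by simp
  then have "(h S2)\<^sup>2 \<le> (card S2 * G)\<^sup>2" using nonneg SV by (intro power_mono)
  also have "\<dots> = card S2 * card S2 * G\<^sup>2" by (simp add: power2_eq_square)
  also have "\<dots> \<le> sum w S2 * G\<^sup>2"
  proof (rule mult_right_mono)
    have "(\<Sum>e\<in>S2. real (card S2)) \<le> (\<Sum>e\<in>S2. w e)"
    proof (rule sum_mono)
      fix e assume "e \<in> S2"
      then have "2 ^ J < 2 * w e" by (simp add: S2_def)
      moreover have "real (2 * card V) \<le> real (2 ^ J)" using J by (simp only: of_nat_le_iff)
      moreover have "card S2 \<le> card V" using SV finite_V by (intro card_mono)
      ultimately show "real (card S2) \<le> w e" by simp
    qed
    then show "real (card S2 * card S2) \<le> sum w S2" by simp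
  qed simp
  finally have h2: "(h S2)\<^sup>2 \<le> (G\<^sup>2 * sum w S2) * 1" by (simp add: mult.commute)
  have "(h S1 + h S2)\<^sup>2 \<le> (G\<^sup>2 * sum w S1 + G\<^sup>2 * sum w S2) * (16 * (potential w' - potential w) + 1)"
    using potential_mono[of w w'] w passes_mono[OF p]
    by (intro add_square_le[OF h1 h2]) (auto intro!: mult_nonneg_nonneg sum_nonneg w0)
  also have "\<dots> = (G\<^sup>2 * sum w S) * (1 + 16 * (potential w' - potential w))"
    using fin SU by (simp add: sum.union_disjoint algebra_simps)
  finally show ?thesis using power_mono[OF subadditive[OF SV] nonneg, of 2] SV SU by simp
qed

text \<open>If some round raises the potential by at most \<open>D\<close>, then
  \<open>round_lower\<close> applies to its initial weights, and the bound persists because weights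
  only grow. Otherwise every round raises the potential by more than \<open>D\<close>, starting from
  0.\<close>

lemma rounds_lower_or_potential:
  assumes "rounds V h G J t w" and G: "0 < G" and J: "2 * card V \<le> (2::nat) ^ J" and D: "0 \<le> D"
  shows "(\<forall>S. S \<subseteq> V \<longrightarrow> (\<forall>e\<in>S. h {e} \<le> G) \<longrightarrow> (h S)\<^sup>2 \<le> (G\<^sup>2 * sum w S) * (1 + 16 * D)) \<or>
    t * D \<le> potential w"
  using assms(1)
proof (induction rule: rounds.induct)
  case zero
  then show ?case by (simp add: potential_def)
next
  case (Suc t w w1)
  have w: "1 \<le> w e" for e using rounds_ge_1[OF Suc.hyps(1)] .
  have mono: "w e \<le> w1 e" for e using passes_mono[OF Suc.hyps(2)] .
  have trans: "(h S)\<^sup>2 \<le> (G\<^sup>2 * sum w1 S) * (1 + 16 * D)"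
    if "(h S)\<^sup>2 \<le> (G\<^sup>2 * sum w S) * (1 + 16 * D)" for S
    using that D by (elim order_trans) (intro mult_right_mono mult_left_mono sum_mono mono; simp)
  show ?case
  proof (cases "t * D \<le> potential w \<and> D < potential w1 - potential w")
    case True
    then show ?thesis by (simp add: algebra_simps)
  next
    case False
    show ?thesis
    proof (intro disjI1 allI impI trans)
      fix S assume S: "S \<subseteq> V" "\<forall>e\<in>S. h {e} \<le> G"
      show "(h S)\<^sup>2 \<le> (G\<^sup>2 * sum w S) * (1 + 16 * D)"
      proof (cases "t * D \<le> potential w")
        case True
        have "(h S)\<^sup>2 \<le> (G\<^sup>2 * sum w S) * (1 + 16 * (potential w1 - potential w))"
          using S by (intro round_lower[OF Suc.hyps(2) G w J]) auto
        also have "\<dots> \<le> (G\<^sup>2 * sum w S) * (1 + 16 * D)"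
          using True False w by (intro mult_left_mono mult_nonneg_nonneg sum_nonneg) (auto intro: order_trans[OF zero_le_one])
        finally show ?thesis .
      qed (use Suc.IH S in blast)
    qed
  qed
qed

text \<open>All weights stay below \<open>2 + card V * J\<close>, so the potential stays below
  \<open>card V\<close> times the logarithm of that number. Hence not all of the
  \<open>card V\<close> rounds can raise it by this logarithm.\<close>

lemma rounds_lower:
  assumes r: "rounds V h G J (card V) w" and G: "0 \<le> G" and J: "2 * card V \<le> (2::nat) ^ J"
    and S: "S \<subseteq> V" "\<And>e. e \<in> S \<Longrightarrow> h {e} \<le> G"
  shows "(h S)\<^sup>2 \<le> (G\<^sup>2 * sum w S) * (1 + 16 * ln (2 + card V * J))"
\<comment> \<open>In both degenerate cases \<open>h S = 0\<close>, since \<open>h S\<close> is at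
  most the sum of its singleton values.\<close>
proof (cases "G = 0 \<or> S = {}")
  case True
  have "h S \<le> (\<Sum>e\<in>S. h {e})" using S by (intro le_sum_singletons)
  also have "\<dots> \<le> (\<Sum>e\<in>S. G)" using S by (intro sum_mono) auto
  finally have "h S \<le> 0" using True by auto
  then have "h S = 0" using nonneg[of S] S by simp
  then show ?thesis using True by auto
next
  case False
  then have G0: "0 < G" and V: "0 < card V" using G S finite_V by (auto simp: card_gt_0_iff)
  have w: "1 \<le> w e" for e using rounds_ge_1[OF r] .
  let ?D = "ln (2 + card V * J)"
  have "potential w < (\<Sum>e\<in>V. ?D)"
    unfolding potential_def
  proof (rule sum_strict_mono)
    fix e assume "e \<in> V"
    then have "w e \<le> 1 + card V * J" using rounds_upper(2)[OF r G] by simp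
    then show "ln (w e) < ?D" using w[of e] by (subst ln_less_cancel_iff) auto
  qed (use finite_V V in auto)
  then have "\<not> card V * ?D \<le> potential w" by simp
  then show ?thesis using rounds_lower_or_potential[OF r G0 J, of ?D] S by simp
qed

end

section \<open>The approximation guarantee\<close>

text \<open>
  Lowering the value at \<open>{}\<close> to \<open>0\<close> preserves submodularity and makes the function subadditive with
  marginals summing to its value; the empty set itself is the program's initial candidate.
\<close>

definition normalize :: "('a set \<Rightarrow> real) \<Rightarrow> 'a set \<Rightarrow> real" where
  "normalize h S = (if S = {} then 0 else h S)"

lemma normalized_submodular_normalize:
  assumes "finite V" "\<forall>S\<subseteq>V. 0 \<le> h S" "mono_on (Pow V) h" "submodular_on V h"
  shows "normalized_submodular V (normalize h)"
proof
  show "finite V" by (rule assms)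
  show "normalize h {} = 0" by (simp add: normalize_def)
next
  fix A B assume AB: "A \<subseteq> B" "B \<subseteq> V"
  then have "h A \<le> h B" using mono_onD[OF assms(3), of A B] by simp
  moreover have "0 \<le> h B" using assms(2) AB by simp
  ultimately show "normalize h A \<le> normalize h B"
    using AB by (auto simp: normalize_def)
next
  fix A B e assume AB: "A \<subseteq> B" "B \<subseteq> V" "e \<in> V - B"
  then have "h (B \<union> {e}) - h B \<le> h (A \<union> {e}) - h A"
    using assms(4) unfolding submodular_on_def by blast
  moreover have "0 \<le> h {}" using assms(2) by simp
  ultimately show "normalize h (insert e B) - normalize h B \<le> normalize h (insert e A) - normalize h A"
    using AB by (auto simp: normalize_def)
qed

definition dense :: "('a set \<Rightarrow> real) \<Rightarrow> ('a set \<Rightarrow> real) \<Rightarrow> 'a set set \<Rightarrow> ('a \<Rightarrow> real) \<Rightarrow> real \<Rightarrow> real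
    \<Rightarrow> 'a set \<Rightarrow> 'a \<Rightarrow> bool" where
  "dense f g \<I> w G l S e \<longleftrightarrow> g {e} \<le> G \<and> insert e S \<in> \<I> \<and> l * w e \<le> f (insert e S) - f S"

text \<open>The factor of \<open>rounds_lower\<close> for \<open>J = scales n\<close>: the loss in
  bounding \<open>(g S)\<^sup>2\<close> by \<open>G\<^sup>2 * sum w S\<close>.\<close>

definition distortion :: "nat \<Rightarrow> real" where
  "distortion n = 1 + 16 * ln (2 + real (n * scales n))"

text \<open>The root combines the losses of the lower and the upper bound on the weights, and 4
  comes from the density greedy. The summand 1 keeps the factor at least 1 even for
  \<open>n = 0\<close>.\<close>

definition ratio_factor :: "nat \<Rightarrow> real" where
  "ratio_factor n = 1 + 4 * sqrt (distortion n * real (n * (scales n + 1)))"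

lemma distortion_ge_1: "1 \<le> distortion n"
  by (simp add: distortion_def)

lemma ratio_factor_ge_1: "1 \<le> ratio_factor n"
  using distortion_ge_1[of n] by (simp add: ratio_factor_def)

text \<open>The least \<open>i\<close> with \<open>2 * r <= 2 ^ i\<close> works. The bound in terms
  of \<open>b\<close> later limits the number of densities to be tried.\<close>

lemma exists_halving:
  fixes r b :: real
  assumes "1 \<le> r" "r \<le> b"
  shows "\<exists>i. 2 * r \<le> 2 ^ i \<and> 2 ^ i \<le> 4 * r \<and> 2 ^ i \<le> 4 * b"
proof -
  obtain m where m: "2 * r < 2 ^ m" using real_arch_pow[of 2 "2 * r"] by auto
  define i where "i = (LEAST i. 2 * r \<le> 2 ^ i)"
  have 1: "2 * r \<le> 2 ^ i" unfolding i_def using less_imp_le[OF m] by (rule LeastI)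
  have "2 ^ i \<le> 4 * r"
  proof (cases i)
    case (Suc k)
    then have "\<not> 2 * r \<le> 2 ^ k" unfolding i_def using not_less_Least[of k "\<lambda>i. 2 * r \<le> 2 ^ i"] by simp
    then show ?thesis using Suc by simp
  qed (use assms in simp)
  then show ?thesis using 1 assms by (intro exI[of _ i]) auto
qed

text \<open>The order of the quantifiers follows the program: \<open>x\<close> fixes
  \<open>G\<close> before the weights are computed, whereas \<open>y\<close> and \<open>i\<close>
  depend on the weights. All runs are covered, so the one that is executed is too.\<close>

lemma good_candidate:
  fixes V :: "'a set"
  assumes f: "matroid_normalized_submodular V f \<I>" and g: "normalized_submodular V g"
    and n: "n = card V" and X: "X \<in> \<I>" "0 < f X"
  shows "\<exists>x\<in>X. \<forall>w. rounds V g (g {x}) (scales n) n w \<longrightarrow> (\<exists>y\<in>X. \<exists>i<3*n+4. \<forall>xs.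
    greedy_run V f (dense f g \<I> w (g {x}) (f {y} / w y / 2 ^ i)) xs \<longrightarrow>
      0 < f (set xs) \<and> f X * g (set xs) \<le> ratio_factor n * (f (set xs) * g X))"
proof -
  interpret f: matroid_normalized_submodular V f \<I> by (rule f)
  interpret g: normalized_submodular V g by (rule g)
  define J where "J = scales n"
  have XV: "X \<subseteq> V" using X f.indep_subset_ground by auto
  have finX: "finite X" using XV f.finite_V finite_subset by blast
  have Xne: "X \<noteq> {}" using X f.empty by auto
  have n0: "0 < n" using Xne XV f.finite_V n by (auto simp: card_gt_0_iff)
  obtain x where x: "x \<in> X" and "g {x} = Max ((\<lambda>e. g {e}) ` X)"
    using obtains_MAX[OF finX Xne, of "\<lambda>e. g {e}"] by metis
  then have xmax: "g {e} \<le> g {x}" if "e \<in> X" for e using that finX by simp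
  define G where "G = g {x}"
  have G0: "0 \<le> G" using g.nonneg[of "{x}"] x XV by (auto simp: G_def)
  have Gg: "G \<le> g X" using g.mono[of "{x}" X] x XV by (auto simp: G_def)
  have "\<exists>y\<in>X. \<exists>i<3*n+4. \<forall>xs. greedy_run V f (dense f g \<I> w G (f {y} / w y / 2 ^ i)) xs \<longrightarrow>
      0 < f (set xs) \<and> f X * g (set xs) \<le> ratio_factor n * (f (set xs) * g X)"
    if r: "rounds V g G (scales n) n w" for w
  proof -
    have w1: "1 \<le> w e" for e using g.rounds_ge_1[OF r] .
    have w0: "0 < w e" for e using w1[of e] by simp
    define W where "W = sum w X"
    have W1: "1 \<le> W" 
      using member_le_sum[of x X w] x finX w0 w1[of x] by (force simp: W_def less_imp_le)
    have "W \<le> (\<Sum>e\<in>X. 1 + real n * J)"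
      unfolding W_def using g.rounds_upper(2)[OF r G0] XV by (intro sum_mono) (auto simp: J_def)
    also have "\<dots> \<le> n * (1 + real n * J)"
      using card_mono[OF f.finite_V XV] n by (simp add: mult_right_mono)
    finally have Wn: "W \<le> n * (1 + real n * J)" .
    \<comment> \<open>Since \<open>G <= g X\<close>, the contribution of the initial weights 1 is
      absorbed into a multiple of \<open>(g X)\<^sup>2\<close>.\<close>
    have "W * G\<^sup>2 \<le> card X * G\<^sup>2 + n * J * (g X)\<^sup>2"
      using g.rounds_upper(1)[OF r G0 XV] by (simp add: W_def J_def)
    also have "\<dots> \<le> n * (g X)\<^sup>2 + n * J * (g X)\<^sup>2"
      using card_mono[OF f.finite_V XV] n power_mono[OF Gg G0, of 2]
      by (intro add_mono mult_mono) auto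
    finally have WG: "W * G\<^sup>2 \<le> real (n * (J + 1)) * (g X)\<^sup>2" by (simp add: algebra_simps)
    obtain y where y: "y \<in> X" and "f {y} / w y = Max ((\<lambda>e. f {e} / w e) ` X)"
      using obtains_MAX[OF finX Xne, of "\<lambda>e. f {e} / w e"] by metis
    then have ymax: "f {e} / w e \<le> f {y} / w y" if "e \<in> X" for e using that finX by simp
    \<comment> \<open>The best density of a single element of \<open>X\<close>. From
      \<open>f X <= q * W\<close> and, as weights are at least 1, \<open>q <= f X\<close>, the
      number \<open>r\<close> below lies between 1 and \<open>W\<close>.\<close>
    define q where "q = f {y} / w y"
    have "f X \<le> (\<Sum>e\<in>X. f {e})" using XV by (rule f.le_sum_singletons)
    also have "\<dots> \<le> (\<Sum>e\<in>X. q * w e)"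
      using ymax w0 by (intro sum_mono) (auto simp: q_def field_simps)
    also have "\<dots> = q * W" by (simp add: W_def sum_distrib_left)
    finally have qW: "f X \<le> q * W" .
    have "0 \<le> f {y}" using f.nonneg[of "{y}"] y XV by auto
    then have "q \<le> f {y}" using w1[of y] w0[of y]
      by (auto simp: q_def divide_le_eq mult_le_cancel_left1)
    also have "f {y} \<le> f X" using y XV by (intro f.mono) auto
    finally have qf: "q \<le> f X" .
    define r where "r = q * W / f X"
    have "1 \<le> r" "r \<le> W" using qW qf X W1 by (auto simp: r_def field_simps)
    then obtain i where i: "2 * r \<le> 2 ^ i" "2 ^ i \<le> 4 * r" "2 ^ i \<le> 4 * W"
      using exists_halving by blast
    \<comment> \<open>The crude estimates \<open>scales n <= 2 * n\<close> and
      \<open>n < 2 ^ n\<close> turn the polynomial bound on \<open>W\<close> into a linear one on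
      \<open>i\<close>.\<close>
    have "real (2 ^ i) \<le> 4 * (n * (1 + real n * J))" using i Wn by simp
    also have "\<dots> = real (4 * (n * (1 + n * J)))" by (simp add: algebra_simps)
    finally have "(2::nat) ^ i \<le> 4 * (n * (1 + n * J))" by (simp only: of_nat_le_iff)
    also have "\<dots> \<le> 4 * (n * (1 + n * (2 * n)))" using scales_le[of n] by (simp add: J_def)
    also have "\<dots> < 16 * (n * (n * n))" 
    proof -
      have "n * 1 \<le> n * (n * n)" using n0 by (intro mult_left_mono) auto
      moreover have "0 < n * (n * n)" using n0 by simp
      moreover have "4 * (n * (1 + n * (2 * n))) = 4 * n + 8 * (n * (n * n))" by (simp add: algebra_simps)
      ultimately show ?thesis by linarith
    qed
    also have "\<dots> \<le> 16 * (2 ^ n * (2 ^ n * 2 ^ n))"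
      using less_exp[of n] by (intro mult_mono) auto
    also have "\<dots> = 2 ^ (3 * n + 4)"
    proof -
      have "3 * n + 4 = 4 + (n + (n + n))" by simp
      then show ?thesis by (simp only: power_add) simp
    qed
    finally have in4: "i < 3 * n + 4" by simp
    define l where "l = f {y} / w y / 2 ^ i"
    have l: "l = q / 2 ^ i" by (simp add: l_def q_def)
    have q0: "0 < q" using qW X W1 by (smt (verit) mult_nonneg_nonneg mult_nonpos_nonneg)
    have l0: "0 < l" using q0 by (simp add: l)
    \<comment> \<open>The window for \<open>l\<close>: the product \<open>l * W\<close> lies between
      a quarter and a half of \<open>f X\<close>.\<close>
    have l1: "2 * (l * W) \<le> f X"
      using i(1) X by (simp add: l r_def field_simps)
    have l2: "f X \<le> 4 * (l * W)"
      using i(2) X by (simp add: l r_def field_simps)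
    have "0 < f (set xs) \<and> f X * g (set xs) \<le> ratio_factor n * (f (set xs) * g X)"
      if run: "greedy_run V f (dense f g \<I> w G l) xs" for xs
    proof -
      define S where "S = set xs"
      have "dense f g \<I> w G l = (\<lambda>S e. e \<in> {e. g {e} \<le> G} \<and> insert e S \<in> \<I> \<and> l * w e \<le> f (insert e S) - f S)"
        by (intro ext) (simp add: dense_def)
      with run have run': "greedy_run V f (\<lambda>S e. e \<in> {e. g {e} \<le> G} \<and> insert e S \<in> \<I> \<and> l * w e \<le> f (insert e S) - f S) xs"
        by simp
      have w0': "0 \<le> w e" for e using w0[of e] by simp
      note dg = f.density_greedy[OF run' less_imp_le[OF l0] w0', folded S_def]
      have SV: "S \<subseteq> V" using dg(1) f.indep_subset_ground by auto
      have "f X \<le> 2 * f S + l * W" unfolding W_def using X xmax by (intro dg(4)) (auto simp: G_def)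
      with l1 have fS: "f X \<le> 4 * f S" by simp
      then have fS0: "0 < f S" using X by simp
      define K where "K = distortion n"
      define D where "D = sqrt (K * real (n * (J + 1)))"
      have K0: "0 \<le> K" using distortion_ge_1[of n] by (simp add: K_def)
      have "(g S)\<^sup>2 \<le> (G\<^sup>2 * sum w S) * (1 + 16 * ln (2 + card V * J))"
        using r dg(2) SV scales_ge[of n] unfolding J_def n
        by (intro g.rounds_lower G0) auto
      then have gS: "(g S)\<^sup>2 \<le> K * G\<^sup>2 * sum w S" by (simp add: K_def distortion_def n J_def mult_ac)
      have gX0: "0 \<le> g X" using g.nonneg XV by blast
      have gS0: "0 \<le> g S" using g.nonneg SV by blast
      have Dsq: "D\<^sup>2 = K * real (n * (J + 1))" using K0 by (simp add: D_def)
      have KWG: "K * G\<^sup>2 * W \<le> (D * g X)\<^sup>2"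
        using mult_left_mono[OF WG K0] by (simp add: power_mult_distrib Dsq mult_ac)
      have D0: "0 \<le> D" using K0 by (simp add: D_def)
      have main: "f X * g S \<le> 4 * (D * (f S * g X))"
      \<comment> \<open>If \<open>S\<close> is no heavier than \<open>X\<close>, then
        \<open>g S\<close> is controlled directly and \<open>f X <= 4 * f S\<close> suffices. If it
        is heavier, then \<open>l * sum w S <= f S\<close> makes up for the excess weight.\<close>
      proof (cases "sum w S \<le> W")
        case True
        then have "K * G\<^sup>2 * sum w S \<le> K * G\<^sup>2 * W" using K0 by (intro mult_left_mono) auto
        with gS KWG have "(g S)\<^sup>2 \<le> (D * g X)\<^sup>2" by linarith
        then have "g S \<le> D * g X" using D0 gX0 by (intro power2_le_imp_le[of "g S"]) auto
        then have "f X * g S \<le> (4 * f S) * (D * g X)" using fS fS0 gS0 by (intro mult_mono) auto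
        then show ?thesis by (simp add: mult_ac)
      next
        case False
        let ?s = "sum w S"
        have s0: "0 < ?s" using False W1 by simp
        have "(W * g S)\<^sup>2 \<le> W\<^sup>2 * (K * G\<^sup>2 * ?s)"
          using gS by (simp add: power_mult_distrib mult_left_mono)
        \<comment> \<open>Regrouping exposes the factor bounded by \<open>KWG\<close>; the remaining
          \<open>W\<close> is then raised to the larger weight of \<open>S\<close>.\<close>
        also have "\<dots> = (W * ?s) * (K * G\<^sup>2 * W)" by (simp add: power2_eq_square)
        also have "\<dots> \<le> (?s * ?s) * (D * g X)\<^sup>2"
          using False W1 s0 K0 KWG by (intro mult_mono) auto
        also have "\<dots> = (?s * (D * g X))\<^sup>2" by (simp add: power2_eq_square)
        finally have "W * g S \<le> ?s * (D * g X)"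
          using D0 gX0 s0 by (intro power2_le_imp_le[of "W * g S"]) auto
        then have "4 * l * (W * g S) \<le> 4 * l * (?s * (D * g X))"
          using l0 by (intro mult_left_mono) auto
        moreover have "f X * g S \<le> 4 * (l * W) * g S" using l2 gS0 by (intro mult_right_mono)
        moreover have "l * ?s * (4 * D * g X) \<le> f S * (4 * D * g X)"
          using dg(3) D0 gX0 by (intro mult_right_mono) auto
        ultimately show ?thesis by (simp add: mult_ac)
      qed
      have "0 \<le> f S * g X" using fS0 gX0 by simp
      with main have "f X * g S \<le> ratio_factor n * (f S * g X)"
        by (simp add: ratio_factor_def D_def K_def J_def algebra_simps)
      with fS0 show ?thesis by (simp add: S_def)
    qed
    then show ?thesis using y in4 by (auto simp: l_def)
  qed
  then show ?thesis using x by (auto simp: G_def)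
qed

text \<open>Replacing \<open>scales n\<close> by its logarithmic bound leaves an elementary
  function, whose growth \<open>real_asymp\<close> can decide.\<close>

lemma ratio_factor_bigo: "ratio_factor \<in> O(\<lambda>n. sqrt (real n) * ln (real n))"
proof -
  define b :: "nat \<Rightarrow> real" where
    "b = (\<lambda>n. 1 + 4 * sqrt ((1 + 16 * ln (2 + n * (2 + log 2 n))) * (n * (3 + log 2 n))))"
  have "eventually (\<lambda>n. norm (ratio_factor n) \<le> 1 * norm (b n)) at_top"
    using eventually_gt_at_top[of 0]
  proof eventually_elim
    case (elim n)
    have j: "real (scales n) \<le> 2 + log 2 n" by (rule scales_le_log) (rule elim)
    have 1: "distortion n \<le> 1 + 16 * ln (2 + n * (2 + log 2 n))"
      using j mult_left_mono[OF j, of "real n"] unfolding distortion_def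
      by (intro add_left_mono mult_left_mono ln_mono) (auto simp: add_pos_nonneg)
    have 2: "real (n * (scales n + 1)) \<le> n * (3 + log 2 n)"
      using j mult_left_mono[of "real (scales n) + 1" "3 + log 2 n" "real n"] by (simp add: distrib_left)
    have "ratio_factor n \<le> b n"
      unfolding ratio_factor_def b_def using distortion_ge_1[of n] 1 2
      by (intro add_left_mono mult_left_mono real_sqrt_le_mono mult_mono) auto
    then show ?case using ratio_factor_ge_1[of n] by simp
  qed
  then have "ratio_factor \<in> O(b)" by (rule bigoI)
  also have "b \<in> O(\<lambda>n. sqrt (real n) * ln (real n))" unfolding b_def by real_asymp
  finally show ?thesis .
qed

section \<open>Total correctness with running times\<close>

text \<open>A weakest precondition for total correctness whose postcondition also sees the running
  time. The rules below are equivalences wherever possible, so that the simplifier executes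
  loop-free code.\<close>

definition wpt where
  "wpt n val indep c s Q \<longleftrightarrow> (\<exists>t s'. exec n val indep c s t s' \<and> Q t s')"

lemma wpt_mono:
  "wpt n val indep c s Q \<Longrightarrow> (\<And>t s'. Q t s' \<Longrightarrow> R t s') \<Longrightarrow> wpt n val indep c s R"
  by (auto simp: wpt_def)

inductive_cases exec_SkipE: "exec n val indep Skip s t s'"
inductive_cases exec_NAssignE: "exec n val indep (NAssign x i a) s t s'"
inductive_cases exec_RAssignE: "exec n val indep (RAssign x i r) s t s'"
inductive_cases exec_QValueE: "exec n val indep (QValue q x i A) s t s'"
inductive_cases exec_QIndepE: "exec n val indep (QIndep x i A) s t s'"
inductive_cases exec_SeqE: "exec n val indep (Seq c1 c2) s t s'"
inductive_cases exec_CondE: "exec n val indep (Cond b c1 c2) s t s'"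

lemma wpt_Skip: "wpt n val indep Skip s Q \<longleftrightarrow> Q 1 s"
  unfolding wpt_def One_nat_def by (blast intro: exec.Skip[unfolded One_nat_def] elim: exec_SkipE)

lemma wpt_NAssign:
  "wpt n val indep (NAssign x i a) s Q \<longleftrightarrow> Q 1 (nupd x (nval i s) (nval a s) s)"
  unfolding wpt_def One_nat_def by (blast intro: exec.NAssign[unfolded One_nat_def] elim: exec_NAssignE)

lemma wpt_RAssign:
  "wpt n val indep (RAssign x i r) s Q \<longleftrightarrow> Q 1 (rupd x (nval i s) (rval r s) s)"
  unfolding wpt_def One_nat_def by (blast intro: exec.RAssign[unfolded One_nat_def] elim: exec_RAssignE)

lemma wpt_QValue:
  "wpt n val indep (QValue q x i A) s Q \<longleftrightarrow> Q 1 (rupd x (nval i s) (val q (set_of n A s)) s)"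
  unfolding wpt_def One_nat_def by (blast intro: exec.QValue[unfolded One_nat_def] elim: exec_QValueE)

lemma wpt_QIndep:
  "wpt n val indep (QIndep x i A) s Q \<longleftrightarrow>
     Q 1 (nupd x (nval i s) (if indep (set_of n A s) then 1 else 0) s)"
proof
  show "wpt n val indep (QIndep x i A) s Q \<Longrightarrow>
    Q 1 (nupd x (nval i s) (if indep (set_of n A s) then 1 else 0) s)"
    unfolding wpt_def by (auto elim!: exec_QIndepE)
  show "Q 1 (nupd x (nval i s) (if indep (set_of n A s) then 1 else 0) s) \<Longrightarrow>
    wpt n val indep (QIndep x i A) s Q"
    unfolding wpt_def using exec.QIndep by blast
qed

lemma wpt_Seq:
  "wpt n val indep (Seq c1 c2) s Q \<longleftrightarrow>
     wpt n val indep c1 s (\<lambda>t1 s1. wpt n val indep c2 s1 (\<lambda>t2 s2. Q (t1 + t2) s2))"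
  unfolding wpt_def by (blast intro: exec.Seq elim: exec_SeqE)

lemma wpt_Cond:
  "wpt n val indep (Cond b c1 c2) s Q \<longleftrightarrow>
     (if bval b s then wpt n val indep c1 s (\<lambda>t s'. Q (1 + t) s')
      else wpt n val indep c2 s (\<lambda>t s'. Q (1 + t) s'))"
proof (cases "bval b s")
  case True
  then show ?thesis unfolding wpt_def plus_1_eq_Suc by simp (blast intro: exec.CondTrue[unfolded plus_1_eq_Suc] elim: exec_CondE)
next
  case False
  then show ?thesis unfolding wpt_def plus_1_eq_Suc by simp (blast intro: exec.CondFalse[unfolded plus_1_eq_Suc] elim: exec_CondE)
qed

lemmas wpt_simps [simp] =
  wpt_Skip wpt_NAssign wpt_RAssign wpt_QValue wpt_QIndep wpt_Seq wpt_Cond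

text \<open>The invariant carries a ghost iteration count, which replaces a termination measure.
  Each iteration is charged one step for its test, and the last test accounts for the summand
  1.\<close>

lemma wpt_While:
  assumes "\<And>j s. Inv j s \<Longrightarrow> bval b s \<longleftrightarrow> j < m"
    and "\<And>j s. j < m \<Longrightarrow> Inv j s \<Longrightarrow> wpt n val indep c s (\<lambda>t s'. t \<le> B \<and> Inv (Suc j) s')"
    and "Inv 0 s"
  shows "wpt n val indep (While b c) s (\<lambda>t s'. t \<le> 1 + m * (B + 1) \<and> Inv m s')"
proof -
  have "\<exists>t s'. exec n val indep (While b c) s t s' \<and> t \<le> 1 + (m - j) * (B + 1) \<and> Inv m s'"
    if "j \<le> m" "Inv j s" for j s
    using that
  proof (induction "m - j" arbitrary: j s)
    case 0
    then have "\<not> bval b s" "j = m" using assms(1) by auto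
    then show ?case using 0 exec.WhileFalse[of b s n val indep c] by (intro exI[of _ 1] exI[of _ s]) auto
  next
    case (Suc d)
    then have b: "bval b s" using assms(1) by auto
    obtain t1 s1 where 1: "exec n val indep c s t1 s1" "t1 \<le> B" "Inv (Suc j) s1"
      using assms(2)[of j s] Suc.prems Suc.hyps(2) unfolding wpt_def by fastforce
    have d: "d = m - Suc j" "Suc j \<le> m" using Suc.hyps(2) by auto
    obtain t2 s2 where 2: "exec n val indep (While b c) s1 t2 s2"
      "t2 \<le> 1 + (m - Suc j) * (B + 1)" "Inv m s2"
      using Suc.hyps(1)[OF d 1(3)] by blast
    have "m - j = Suc (m - Suc j)" using Suc.hyps(2) by simp
    then have "1 + t1 + t2 \<le> 1 + (m - j) * (B + 1)" using 1(2) 2(2) by simp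
    then show ?case using exec.WhileTrue[OF b 1(1) 2(1)] 2(3) by blast
  qed
  from this[of 0 s] assms(3) show ?thesis by (auto simp: wpt_def)
qed

abbreviation nvar :: "vname \<Rightarrow> nexp" where "nvar x \<equiv> NAt x (NConst 0)"
abbreviation rvar :: "vname \<Rightarrow> rexp" where "rvar x \<equiv> RAt x (NConst 0)"

definition For :: "vname \<Rightarrow> nexp \<Rightarrow> com \<Rightarrow> com" where
  "For i ub c = Seq (NAssign i (NConst 0) (NConst 0))
     (While (NLess (nvar i) ub) (Seq c (NAssign i (NConst 0) (NAdd (nvar i) (NConst 1)))))"

text \<open>The body has to leave the counter intact and to establish the invariant for the state
  after the increment. The constants count the initial assignment, the tests and the
  increments.\<close>

lemma wpt_For:
  assumes "Inv 0 (nupd i 0 0 s)"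
    and "\<And>k s. Inv k s \<Longrightarrow> nval ub s = m"
    and "\<And>k s. k < m \<Longrightarrow> Inv k s \<Longrightarrow> nats s i 0 = k \<Longrightarrow>
      wpt n val indep c s (\<lambda>t s'. t \<le> B \<and> nats s' i 0 = k \<and> Inv (Suc k) (nupd i 0 (Suc k) s'))"
  shows "wpt n val indep (For i ub c) s (\<lambda>t s'. t \<le> 2 + m * (B + 2) \<and> Inv m s')"
proof -
  have "wpt n val indep (While (NLess (nvar i) ub) (Seq c (NAssign i (NConst 0) (NAdd (nvar i) (NConst 1)))))
    (nupd i 0 0 s) (\<lambda>t s'. t \<le> 1 + m * ((B + 1) + 1) \<and> (Inv m s' \<and> nats s' i 0 = m))"
  proof (rule wpt_While[where Inv = "\<lambda>k s. Inv k s \<and> nats s i 0 = k"])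
    fix j s assume j: "j < m" "Inv j s \<and> nats s i 0 = j"
    from assms(3)[of j s] j show "wpt n val indep (Seq c (NAssign i (NConst 0) (NAdd (nvar i) (NConst 1)))) s
      (\<lambda>t s'. t \<le> B + 1 \<and> Inv (Suc j) s' \<and> nats s' i 0 = Suc j)"
      by (auto elim!: wpt_mono simp: nupd_def)
  qed (use assms(1,2) in \<open>auto simp: nupd_def\<close>)
  then show ?thesis unfolding For_def by (auto elim!: wpt_mono)
qed

section \<open>Frame conditions and characteristic vectors\<close>

lemma upd_simps [simp]:
  "nats (nupd x i v s) = (nats s)(x := (nats s x)(i := v))"
  "reals (nupd x i v s) = reals s"
  "nats (rupd x i r s) = nats s"
  "reals (rupd x i r s) = (reals s)(x := (reals s x)(i := r))"
  by (simp_all add: nupd_def rupd_def)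

definition unchanged :: "vname set \<Rightarrow> vname set \<Rightarrow> state \<Rightarrow> state \<Rightarrow> bool" where
  "unchanged X Y s s' \<longleftrightarrow> (\<forall>x. x \<notin> X \<longrightarrow> nats s' x = nats s x) \<and> (\<forall>y. y \<notin> Y \<longrightarrow> reals s' y = reals s y)"

lemma unchanged_refl [simp]: "unchanged X Y s s"
  by (simp add: unchanged_def)

lemma unchanged_upd [simp]:
  "x \<in> X \<Longrightarrow> unchanged X Y s s' \<Longrightarrow> unchanged X Y s (nupd x i v s')"
  "y \<in> Y \<Longrightarrow> unchanged X Y s s' \<Longrightarrow> unchanged X Y s (rupd y i r s')"
  by (auto simp: unchanged_def)

lemma unchanged_trans:
  "unchanged X Y s s' \<Longrightarrow> unchanged X' Y' s' s'' \<Longrightarrow> X \<union> X' \<subseteq> X'' \<Longrightarrow> Y \<union> Y' \<subseteq> Y'' \<Longrightarrow>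
    unchanged X'' Y'' s s''"
  unfolding unchanged_def by (metis Un_iff subsetD)

lemma unchangedD:
  assumes "unchanged X Y s s'"
  shows "x \<notin> X \<Longrightarrow> nats s' x = nats s x" "y \<notin> Y \<Longrightarrow> reals s' y = reals s y"
  using assms by (auto simp: unchanged_def)

definition bits :: "nat \<Rightarrow> (nat \<Rightarrow> nat) \<Rightarrow> nat set" where
  "bits n a = {i. i < n \<and> a i \<noteq> 0}"

lemma set_of_bits [simp]: "set_of n x s = bits n (nats s x)"
  by (simp add: set_of_def bits_def)

lemma bits_upd [simp]:
  "e < n \<Longrightarrow> bits n (a(e := v)) = (if v = 0 then bits n a - {e} else insert e (bits n a))"
  by (auto simp: bits_def)

lemma bits_subset: "bits n a \<subseteq> {..<n}"
  by (auto simp: bits_def)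

text \<open>
  Candidates in \<open>greedy q b y\<close> have to pass the test \<open>b\<close>, which may refer to the independence bit
  \<open>ind\<close> and the value \<open>v\<close> of \<open>S \<union> {e}\<close> and to the value \<open>cur\<close> of \<open>S\<close>, where \<open>cur = 0\<close> for \<open>S = {}\<close>.
  The array \<open>y\<close> collects \<open>((v - cur) / gs[x])\<^sup>2\<close>; the value \<open>n\<close> of \<open>b\<close> means that no candidate is left.
\<close>

definition update_best :: "bexp \<Rightarrow> com" where
  "update_best b =
    Cond (BAnd b (BNot (BAnd (NLess (nvar ''b'') (nvar ''n'')) (BNot (RLess (rvar ''bv'') (rvar ''v''))))))
      (Seq (NAssign ''b'' (NConst 0) (nvar ''e'')) (RAssign ''bv'' (NConst 0) (rvar ''v'')))
      Skip"

definition scan :: "value_oracle \<Rightarrow> bexp \<Rightarrow> com" where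
  "scan q b =
    Cond (NLess (NAt ''S'' (nvar ''e'')) (NConst 1))
      (Seq (NAssign ''S'' (nvar ''e'') (NConst 1))
      (Seq (QValue q ''v'' (NConst 0) ''S'')
      (Seq (QIndep ''ind'' (NConst 0) ''S'')
      (Seq (NAssign ''S'' (nvar ''e'') (NConst 0))
        (update_best b)))))
      Skip"

definition pick :: "vname \<Rightarrow> com" where
  "pick y =
    (let g = RDiv (RSub (rvar ''bv'') (rvar ''cur'')) (RAt ''gs'' (nvar ''x'')) in
      Seq (RAssign y (nvar ''b'') (RAdd (RAt y (nvar ''b'')) (RMul g g)))
      (Seq (NAssign ''S'' (nvar ''b'') (NConst 1))
        (RAssign ''cur'' (NConst 0) (rvar ''bv''))))"

definition greedy :: "value_oracle \<Rightarrow> bexp \<Rightarrow> vname \<Rightarrow> com" where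
  "greedy q b y =
    Seq (For ''e'' (nvar ''n'') (NAssign ''S'' (nvar ''e'') (NConst 0)))
    (Seq (RAssign ''cur'' (NConst 0) (RNat (NConst 0)))
      (For ''r'' (nvar ''n'')
        (Seq (NAssign ''b'' (NConst 0) (nvar ''n''))
        (Seq (For ''e'' (nvar ''n'') (scan q b))
          (Cond (NLess (nvar ''b'') (nvar ''n'')) (pick y) Skip)))))"

abbreviation greedy_nats :: "vname set" where
  "greedy_nats \<equiv> {''S'', ''e'', ''r'', ''b'', ''ind''}"
abbreviation greedy_reals :: "vname set" where
  "greedy_reals \<equiv> {''v'', ''cur'', ''bv''}"

definition greedy_time :: "nat \<Rightarrow> nat" where
  "greedy_time n = 3 + (2 + n * 3) + (2 + n * ((7 + (2 + n * 12)) + 2))"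

definition best_upto :: "nat \<Rightarrow> (nat set \<Rightarrow> real) \<Rightarrow> (nat set \<Rightarrow> nat \<Rightarrow> bool) \<Rightarrow> nat set \<Rightarrow> nat \<Rightarrow> nat \<Rightarrow> real \<Rightarrow> bool" where
  "best_upto n h elig A k b v \<longleftrightarrow>
    (b = n \<and> (\<forall>e<k. e \<notin> A \<longrightarrow> \<not> elig A e)) \<or>
    (b < n \<and> b \<notin> A \<and> elig A b \<and> v = h (insert b A) \<and>
      (\<forall>e<k. e \<notin> A \<longrightarrow> elig A e \<longrightarrow> h (insert e A) \<le> v))"

text \<open>The test \<open>b\<close> needs to agree with \<open>elig\<close> only in states in
  which the scan evaluates it. There \<open>e\<close> has not been picked yet, so its entry in
  \<open>y\<close> is still the initial one; this is why a pass may update the weights that it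
  tests.\<close>

lemma wpt_greedy:
  fixes val :: "value_oracle \<Rightarrow> nat set \<Rightarrow> real" and q :: value_oracle and n :: nat
  defines "h \<equiv> normalize (val q)" and "V \<equiv> {..<n}"
  assumes n: "nats s0 ''n'' 0 = n" and y: "y \<notin> greedy_reals \<union> {''gs''}"
    and test: "\<And>s A e. e < n \<Longrightarrow> e \<notin> A \<Longrightarrow> A \<subseteq> V \<Longrightarrow>
      unchanged greedy_nats (insert y greedy_reals) s0 s \<Longrightarrow> nats s ''e'' 0 = e \<Longrightarrow>
      nats s ''ind'' 0 = (if indep (insert e A) then 1 else 0) \<Longrightarrow>
      reals s ''v'' 0 = h (insert e A) \<Longrightarrow> reals s ''cur'' 0 = h A \<Longrightarrow> reals s y e = reals s0 y e \<Longrightarrow>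
      bval b s \<longleftrightarrow> elig A e"
  shows "wpt n val indep (greedy q b y) s0 (\<lambda>t s. t \<le> greedy_time n \<and>
    unchanged greedy_nats (insert y greedy_reals) s0 s \<and>
    (\<exists>xs. greedy_run V h elig xs \<and> bits n (nats s ''S'') = set xs \<and>
      (\<forall>e<n. reals s y e = reweight (reals s0 ''gs'' (nats s0 ''x'' 0)) h xs (reals s0 y) e)))"
proof -
  let ?unch = "unchanged greedy_nats (insert y greedy_reals)"
  define G where "G = reals s0 ''gs'' (nats s0 ''x'' 0)"
  have un: "nats s ''n'' 0 = n" if "?unch s0 s" for s
    using unchangedD(1)[OF that, of "''n''"] n by simp
  have h_insert: "h (insert e A) = val q (insert e A)" for e A by (simp add: h_def normalize_def)
  have clear: "wpt n val indep (For ''e'' (nvar ''n'') (NAssign ''S'' (nvar ''e'') (NConst 0))) s0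
    (\<lambda>t s. t \<le> 2 + n * (1 + 2) \<and> (?unch s0 s \<and> reals s = reals s0 \<and> (\<forall>e<n. nats s ''S'' e = 0)))"
    by (rule wpt_For[where Inv = "\<lambda>k s. ?unch s0 s \<and> reals s = reals s0 \<and> (\<forall>e<k. nats s ''S'' e = 0)"])
      (auto simp: un n less_Suc_eq)
  have scan_loop: "wpt n val indep (For ''e'' (nvar ''n'') (scan q b)) s1
    (\<lambda>t s. t \<le> 2 + n * (10 + 2) \<and> (?unch s0 s \<and> bits n (nats s ''S'') = A \<and>
      reals s ''cur'' 0 = h A \<and> reals s y = reals s1 y \<and> nats s ''r'' = nats s1 ''r'' \<and>
      best_upto n h elig A n (nats s ''b'' 0) (reals s ''bv'' 0)))"
    if s1: "?unch s0 s1" "nats s1 ''b'' 0 = n" "bits n (nats s1 ''S'') = A"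
      "reals s1 ''cur'' 0 = h A" "\<forall>e<n. e \<notin> A \<longrightarrow> reals s1 y e = reals s0 y e" for s1 A
  proof (rule wpt_For[where Inv = "\<lambda>k s. ?unch s0 s \<and> bits n (nats s ''S'') = A \<and>
      reals s ''cur'' 0 = h A \<and> reals s y = reals s1 y \<and> nats s ''r'' = nats s1 ''r'' \<and>
      best_upto n h elig A k (nats s ''b'' 0) (reals s ''bv'' 0)"])
    show "?unch s0 (nupd ''e'' 0 0 s1) \<and> bits n (nats (nupd ''e'' 0 0 s1) ''S'') = A \<and>
      reals (nupd ''e'' 0 0 s1) ''cur'' 0 = h A \<and> reals (nupd ''e'' 0 0 s1) y = reals s1 y \<and>
      nats (nupd ''e'' 0 0 s1) ''r'' = nats s1 ''r'' \<and>
      best_upto n h elig A 0 (nats (nupd ''e'' 0 0 s1) ''b'' 0) (reals (nupd ''e'' 0 0 s1) ''bv'' 0)"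
      using s1 by (simp add: best_upto_def)
  next
    fix k s assume k: "k < n" and e: "nats s ''e'' 0 = k" and
      inv: "?unch s0 s \<and> bits n (nats s ''S'') = A \<and> reals s ''cur'' 0 = h A \<and>
      reals s y = reals s1 y \<and> nats s ''r'' = nats s1 ''r'' \<and> 
      best_upto n h elig A k (nats s ''b'' 0) (reals s ''bv'' 0)"
    have ns: "nats s ''n'' 0 = n" using inv un by simp
    have AV: "A \<subseteq> V" using inv bits_subset by (auto simp: V_def)
    show "wpt n val indep (scan q b) s (\<lambda>t s'. t \<le> 10 \<and> nats s' ''e'' 0 = k \<and>
      (?unch s0 (nupd ''e'' 0 (Suc k) s') \<and> bits n (nats (nupd ''e'' 0 (Suc k) s') ''S'') = A \<and>
      reals (nupd ''e'' 0 (Suc k) s') ''cur'' 0 = h A \<and>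
      reals (nupd ''e'' 0 (Suc k) s') y = reals s1 y \<and>
      nats (nupd ''e'' 0 (Suc k) s') ''r'' = nats s1 ''r'' \<and>
      best_upto n h elig A (Suc k) (nats (nupd ''e'' 0 (Suc k) s') ''b'' 0)
        (reals (nupd ''e'' 0 (Suc k) s') ''bv'' 0)))"
    proof (cases "k \<in> A")
      case True
      then have "nats s ''S'' k \<noteq> 0" using inv k by (auto simp: bits_def)
      then show ?thesis using inv e True
        by (auto simp: scan_def best_upto_def less_Suc_eq)
    next
      case False
      then have S0: "nats s ''S'' k = 0" using inv k by (auto simp: bits_def)
      define s2 where "s2 = nupd ''S'' k 0 (nupd ''ind'' 0 (if indep (insert k A) then 1 else 0)
        (rupd ''v'' 0 (val q (insert k A)) (nupd ''S'' k 1 s)))"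
      have s2: "?unch s0 s2" "nats s2 ''e'' 0 = k" "nats s2 ''ind'' 0 = (if indep (insert k A) then 1 else 0)"
         "reals s2 ''v'' 0 = h (insert k A)" "reals s2 ''cur'' 0 = h A" "reals s2 y = reals s1 y"
         "bits n (nats s2 ''S'') = A" "nats s2 ''n'' 0 = n" "nats s2 ''b'' = nats s ''b''"
         "reals s2 ''bv'' = reals s ''bv''" "nats s2 ''r'' = nats s1 ''r''"
        using inv e y k ns False S0 by (auto simp: s2_def h_insert)
      have bv: "bval b s2 \<longleftrightarrow> elig A k"
        using s2 k False AV s1(5) by (intro test) auto
      \<comment> \<open>The five steps are the membership test and the four commands before
        \<open>update_best\<close>.\<close>
      have step: "wpt n val indep (scan q b) s Q \<longleftrightarrow>
        wpt n val indep (update_best b) s2 (\<lambda>t s'. Q (Suc (Suc (Suc (Suc (Suc t))))) s')" for Q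
        using inv e S0 k by (simp add: scan_def s2_def)
      let ?imp = "elig A k \<and> \<not> (nats s ''b'' 0 < n \<and> \<not> reals s ''bv'' 0 < h (insert k A))"
      show ?thesis
      proof (cases ?imp)
        case True
        then have "best_upto n h elig A (Suc k) k (h (insert k A))"
          using inv k False unfolding best_upto_def by (force simp: less_Suc_eq)
        then show ?thesis using True s2 bv y by (simp add: step update_best_def)
      next
        case F: False
        then have "best_upto n h elig A (Suc k) (nats s ''b'' 0) (reals s ''bv'' 0)"
          using inv k False unfolding best_upto_def by (auto simp: less_Suc_eq)
        moreover have "\<not> bval (BAnd b (BNot (BAnd (NLess (nvar ''b'') (nvar ''n'')) (BNot (RLess (rvar ''bv'') (rvar ''v'')))))) s2"
          using F s2 bv by simp
        ultimately show ?thesis using s2 y by (simp add: step update_best_def del: bval.simps)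
      qed
    qed
  qed (auto simp: un)
  \<comment> \<open>Either each of the \<open>k\<close> iterations has picked an element, or the run
    is complete and further iterations are idle.\<close>
  let ?Inv = "\<lambda>k s. ?unch s0 s \<and> (\<exists>xs. greedy_path V h elig xs \<and> bits n (nats s ''S'') = set xs \<and>
      reals s ''cur'' 0 = h (set xs) \<and> (\<forall>e<n. reals s y e = reweight G h xs (reals s0 y) e) \<and>
      (length xs = k \<or> greedy_run V h elig xs))"
  have main: "wpt n val indep
      (For ''r'' (nvar ''n'')
        (Seq (NAssign ''b'' (NConst 0) (nvar ''n''))
        (Seq (For ''e'' (nvar ''n'') (scan q b))
          (Cond (NLess (nvar ''b'') (nvar ''n'')) (pick y) Skip)))) s
      (\<lambda>t s'. t \<le> 2 + n * ((7 + (2 + n * 12)) + 2) \<and> ?Inv n s')"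
    if s: "?unch s0 s" "\<forall>e<n. nats s ''S'' e = 0" "reals s ''cur'' 0 = 0" "reals s y = reals s0 y" for s
  proof (rule wpt_For[where Inv = ?Inv])
    have "bits n (nats s ''S'') = {}" using s by (auto simp: bits_def)
    then show "?Inv 0 (nupd ''r'' 0 0 s)"
      using s by (auto intro!: exI[of _ "[]"] greedy_path.Nil simp: reweight_def h_def normalize_def)
  next
    fix k s assume "?Inv k s" then show "nval (nvar ''n'') s = n" by (auto simp: un)
  next
    fix k s assume k: "k < n" and r: "nats s ''r'' 0 = k" and inv: "?Inv k s"
    from inv obtain xs where s: "?unch s0 s" and xs: "greedy_path V h elig xs" "bits n (nats s ''S'') = set xs"
      "reals s ''cur'' 0 = h (set xs)" "\<forall>e<n. reals s y e = reweight G h xs (reals s0 y) e"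
      "length xs = k \<or> greedy_run V h elig xs" by blast
    let ?A = "set xs"
    have xsV: "?A \<subseteq> V" using greedy_path_subset[OF xs(1)] by simp
    have ns: "nats s ''n'' 0 = n" using s un by simp
    define s1 where "s1 = nupd ''b'' 0 n s"
    have s1: "?unch s0 s1" "nats s1 ''b'' 0 = n" "bits n (nats s1 ''S'') = ?A"
      "reals s1 ''cur'' 0 = h ?A" "\<forall>e<n. e \<notin> ?A \<longrightarrow> reals s1 y e = reals s0 y e"
      using s xs by (auto simp: s1_def reweight_def)
    have loop: "wpt n val indep (For ''e'' (nvar ''n'') (scan q b)) s1
      (\<lambda>t s. t \<le> 2 + n * (10 + 2) \<and> (?unch s0 s \<and> bits n (nats s ''S'') = ?A \<and>
      reals s ''cur'' 0 = h ?A \<and> reals s y = reals s1 y \<and> nats s ''r'' = nats s1 ''r'' \<and>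
      best_upto n h elig ?A n (nats s ''b'' 0) (reals s ''bv'' 0)))"
      by (rule scan_loop[OF s1])
    have fin: "wpt n val indep (Cond (NLess (nvar ''b'') (nvar ''n'')) (pick y) Skip) s2
        (\<lambda>t s'. t \<le> 4 \<and> nats s' ''r'' 0 = k \<and> ?Inv (Suc k) (nupd ''r'' 0 (Suc k) s'))"
      if s2: "?unch s0 s2" "bits n (nats s2 ''S'') = ?A" "reals s2 ''cur'' 0 = h ?A"
        "reals s2 y = reals s1 y" "nats s2 ''r'' = nats s1 ''r''"
        and best: "best_upto n h elig ?A n (nats s2 ''b'' 0) (reals s2 ''bv'' 0)" for s2
    proof (cases "nats s2 ''b'' 0 = n")
      case True
      then have "greedy_run V h elig xs"
        using best xs(1) by (auto simp: best_upto_def greedy_run_def V_def)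
      then show ?thesis using True s2 xs r by (auto simp: s1_def un)
    next
      case False
      let ?x = "nats s2 ''b'' 0"
      have b: "?x < n" "?x \<notin> ?A" "elig ?A ?x" "reals s2 ''bv'' 0 = h (insert ?x ?A)"
        and max: "\<And>e. e < n \<Longrightarrow> e \<notin> ?A \<Longrightarrow> elig ?A e \<Longrightarrow> h (insert e ?A) \<le> h (insert ?x ?A)"
        using best False by (auto simp: best_upto_def)
      have path: "greedy_path V h elig (xs @ [?x])"
        using xs b max by (intro greedy_path.snoc) (auto simp: V_def)
      have "\<not> greedy_run V h elig xs" using b by (auto simp: greedy_run_def V_def)
      then have len: "length (xs @ [?x]) = Suc k" using xs by simp
      have "''gs'' \<notin> insert y greedy_reals" using y by auto
      then have G2: "reals s2 ''gs'' (nats s2 ''x'' 0) = G"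
        using unchangedD(2)[OF s2(1), of "''gs''"] unchangedD(1)[OF s2(1), of "''x''"] by (simp add: G_def)
      have ns2: "nats s2 ''n'' 0 = n" using s2 un by simp
      have w: "reals s2 y e = reweight G h xs (reals s0 y) e" if "e < n" for e
        using that s2 xs by (simp add: s1_def)
      define w' where "w' = (reals s2 y)(?x := reals s2 y ?x + (h (insert ?x ?A) - h ?A) / G * ((h (insert ?x ?A) - h ?A) / G))"
      have w': "w' e = reweight G h (xs @ [?x]) (reals s0 y) e" if "e < n" for e
        using that w[OF that] b by (cases "e = ?x") (simp_all add: w'_def reweight_def gain_snoc power2_eq_square)
      show ?thesis
        using b s2 path len r y w' G2 ns2 w'_def
        by (auto simp: pick_def Let_def s1_def intro!: exI[of _ "xs @ [?x]"])
    qed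
    show "wpt n val indep
      (Seq (NAssign ''b'' (NConst 0) (nvar ''n'')) (Seq (For ''e'' (nvar ''n'') (scan q b))
          (Cond (NLess (nvar ''b'') (nvar ''n'')) (pick y) Skip))) s
      (\<lambda>t s'. t \<le> 7 + (2 + n * 12) \<and> nats s' ''r'' 0 = k \<and> ?Inv (Suc k) (nupd ''r'' 0 (Suc k) s'))"
      unfolding wpt_NAssign wpt_Seq
      using ns by (simp flip: s1_def del: wpt_simps) (rule wpt_mono[OF loop], rule wpt_mono[OF fin], auto)
  qed
  have "wpt n val indep (greedy q b y) s0 (\<lambda>t s. t \<le> greedy_time n \<and> ?Inv n s)"
    unfolding greedy_def wpt_RAssign wpt_Seq
    by (rule wpt_mono[OF clear], rule wpt_mono[OF main]) (use y in \<open>auto simp: greedy_time_def\<close>)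
  then show ?thesis
  proof (rule wpt_mono)
    fix t s assume s: "t \<le> greedy_time n \<and> ?Inv n s"
    then obtain xs where xs: "greedy_path V h elig xs" "bits n (nats s ''S'') = set xs"
      "\<forall>e<n. reals s y e = reweight G h xs (reals s0 y) e" "length xs = n \<or> greedy_run V h elig xs" by blast
    \<comment> \<open>A path with \<open>n\<close> picks exhausts the ground set, so it is complete
      as well.\<close>
    have "greedy_run V h elig xs"
    proof (cases "length xs = n")
      case True
      have "set xs = V" using greedy_path_subset[OF xs(1)] True
        by (intro card_subset_eq) (auto simp: V_def distinct_card)
      then show ?thesis using xs(1) by (simp add: greedy_run_def)
    qed (use xs in simp)
    then show "t \<le> greedy_time n \<and> ?unch s0 s \<and> (\<exists>xs. greedy_run V h elig xs \<and>
      bits n (nats s ''S'') = set xs \<and> (\<forall>e<n. reals s y e = reweight (reals s0 ''gs'' (nats s0 ''x'' 0)) h xs (reals s0 y) e))"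
      using s xs by (auto simp: G_def)
  qed
qed

section \<open>The program\<close>

definition light_test :: bexp where
  "light_test = BAnd (BNot (RLess (RAt ''gs'' (nvar ''x'')) (RAt ''gs'' (nvar ''e''))))
     (BNot (RLess (RNat (nvar ''k'')) (RAt ''w'' (nvar ''e''))))"

definition dense_test :: bexp where
  "dense_test = BAnd (BNot (RLess (RAt ''gs'' (nvar ''x'')) (RAt ''gs'' (nvar ''e''))))
     (BAnd (NLess (NConst 0) (nvar ''ind''))
       (BNot (RLess (RSub (rvar ''v'') (rvar ''cur'')) (RMul (rvar ''l'') (RAt ''w'' (nvar ''e''))))))"

definition singletons :: com where
  "singletons = For ''e'' (nvar ''n'')
     (Seq (NAssign ''S'' (nvar ''e'') (NConst 1))
     (Seq (QValue Numer ''fs'' (nvar ''e'') ''S'')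
     (Seq (QValue Denom ''gs'' (nvar ''e'') ''S'')
       (NAssign ''S'' (nvar ''e'') (NConst 0)))))"

definition doubling_round :: com where
  "doubling_round = Seq (NAssign ''k'' (NConst 0) (NConst 1))
     (While (NLess (nvar ''k'') (NAdd (nvar ''n'') (nvar ''n'')))
       (Seq (greedy Denom light_test ''w'')
         (NAssign ''k'' (NConst 0) (NAdd (nvar ''k'') (nvar ''k'')))))"

definition weigh :: com where
  "weigh = Seq (For ''e'' (nvar ''n'') (RAssign ''w'' (nvar ''e'') (RNat (NConst 1))))
     (For ''t'' (nvar ''n'') doubling_round)"

text \<open>
  The second disjunct covers a recorded \<open>0 / 0\<close>, on which cross multiplication is inconclusive.
\<close>

definition better :: bexp where
  "better = BNot (BAnd (BNot (RLess (RMul (rvar ''fb'') (rvar ''gc'')) (RMul (rvar ''fc'') (rvar ''gb''))))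
     (BNot (BAnd (BNot (RLess (RNat (NConst 0)) (rvar ''fb''))) (RLess (RNat (NConst 0)) (rvar ''fc'')))))"

definition compare :: com where
  "compare = Seq (QValue Numer ''fc'' (NConst 0) ''S'')
     (Seq (QValue Denom ''gc'' (NConst 0) ''S'')
     (Cond better
       (Seq (RAssign ''fb'' (NConst 0) (rvar ''fc''))
       (Seq (RAssign ''gb'' (NConst 0) (rvar ''gc''))
         (For ''e'' (nvar ''n'') (NAssign ''out'' (nvar ''e'') (NAt ''S'' (nvar ''e''))))))
       Skip))"

text \<open>The greedy call writes its squares to the scratch array \<open>z\<close>, so that the
  weights in \<open>w\<close> stay fixed while the densities are tried.\<close>

definition try_densities :: com where
  "try_densities = Seq (RAssign ''l'' (NConst 0) (RDiv (RAt ''fs'' (nvar ''y'')) (RAt ''w'' (nvar ''y''))))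
     (For ''i'' (NAdd (nvar ''n'') (NAdd (nvar ''n'') (NAdd (nvar ''n'') (NConst 4))))
       (Seq (greedy Numer dense_test ''z'')
       (Seq compare
         (RAssign ''l'' (NConst 0) (RDiv (rvar ''l'') (RNat (NConst 2)))))))"

definition program :: com where
  "program = Seq (QValue Numer ''fb'' (NConst 0) ''out'')
     (Seq (QValue Denom ''gb'' (NConst 0) ''out'')
     (Seq singletons
       (For ''x'' (nvar ''n'') (Seq weigh (For ''y'' (nvar ''n'') try_densities)))))"

section \<open>Polynomial time bounds\<close>

definition round_time :: "nat \<Rightarrow> nat" where
  "round_time n = 2 + 2 * n * (greedy_time n + 2)"
definition weigh_time :: "nat \<Rightarrow> nat" where
  "weigh_time n = (2 + n * 3) + (2 + n * (round_time n + 2))"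
definition compare_time :: "nat \<Rightarrow> nat" where
  "compare_time n = 7 + n * 3"
definition densities_time :: "nat \<Rightarrow> nat" where
  "densities_time n = 3 + (3 * n + 4) * (greedy_time n + compare_time n + 3)"
definition program_time :: "nat \<Rightarrow> nat" where
  "program_time n = 2 + (2 + n * 6) + (2 + n * (weigh_time n + (2 + n * (densities_time n + 2)) + 2))"

text \<open>Polynomials with natural coefficients are closed under sums and products, so these rules
  bound a time expression by following its syntax.\<close>

lemma poly_bound_intros:
  "\<exists>p. \<forall>n. n \<le> poly p (n::nat)"
  "\<exists>p. \<forall>n. (c::nat) \<le> poly p (n::nat)"
  "\<exists>p. \<forall>n. a n \<le> poly p (n::nat) \<Longrightarrow> \<exists>p. \<forall>n. b n \<le> poly p n \<Longrightarrow> \<exists>p. \<forall>n. a n + b n \<le> (poly p n :: nat)"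
  "\<exists>p. \<forall>n. a n \<le> poly p (n::nat) \<Longrightarrow> \<exists>p. \<forall>n. b n \<le> poly p n \<Longrightarrow> \<exists>p. \<forall>n. a n * b n \<le> (poly p n :: nat)"
proof -
  show "\<exists>p. \<forall>n. n \<le> poly p (n::nat)" by (rule exI[of _ "[:0, 1:]"]) simp
  show "\<exists>p. \<forall>n. c \<le> poly p (n::nat)" by (rule exI[of _ "[:c:]"]) simp
next
  assume "\<exists>p. \<forall>n. a n \<le> poly p (n::nat)" "\<exists>p. \<forall>n. b n \<le> poly p n"
  then obtain p q where "\<forall>n. a n \<le> poly p n" "\<forall>n. b n \<le> poly q n" by blast
  then obtain p q where pq: "\<forall>n. a n \<le> poly p n" "\<forall>n. b n \<le> poly q n" by blast
  then show "\<exists>p. \<forall>n. a n + b n \<le> poly p n"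
    by (intro exI[of _ "p + q"]) (simp add: add_mono)
  show "\<exists>p. \<forall>n. a n * b n \<le> poly p n"
    using pq by (intro exI[of _ "p * q"]) (simp add: mult_mono)
qed

lemma program_time_poly: "\<exists>p. \<forall>n. program_time n \<le> poly p n"
  unfolding program_time_def weigh_time_def round_time_def densities_time_def compare_time_def greedy_time_def
  by (intro poly_bound_intros)

text \<open>A zero numerator gives the quotient 0, even over 0, and a positive numerator over 0
  gives infinity. Cross multiplication decides the remaining cases, in which both denominators are
  positive.\<close>

lemma ratio_compare:
  fixes a b c d :: real
  assumes "0 \<le> a" "0 \<le> b" "0 \<le> c" "0 \<le> d"
  shows "a * d < c * b \<or> \<not> 0 < a \<and> 0 < c \<Longrightarrow> ennreal a / ennreal b \<le> ennreal c / ennreal d"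
    and "\<not> (a * d < c * b \<or> \<not> 0 < a \<and> 0 < c) \<Longrightarrow> ennreal c / ennreal d \<le> ennreal a / ennreal b"
proof -
  assume h: "a * d < c * b \<or> \<not> 0 < a \<and> 0 < c"
  show "ennreal a / ennreal b \<le> ennreal c / ennreal d"
  proof (cases "a = 0")
    case False
    then have *: "a * d < c * b" using h assms by auto
    moreover have "0 \<le> a * d" using assms by simp
    ultimately have "0 < c * b" by linarith
    then have cb: "0 < c" "0 < b" using assms by (auto simp: zero_less_mult_iff)
    show ?thesis
    proof (cases "d = 0")
      case True
      then show ?thesis using cb by (simp add: ennreal_divide_zero)
    next
      case d: False
      then show ?thesis using cb assms * by (simp add: divide_ennreal ennreal_leI field_simps less_imp_le)
    qed
  qed simp
next
  assume h: "\<not> (a * d < c * b \<or> \<not> 0 < a \<and> 0 < c)"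
  show "ennreal c / ennreal d \<le> ennreal a / ennreal b"
  proof (cases "c = 0")
    case False
    then have a: "0 < a" "c * b \<le> a * d" using h assms by auto
    show ?thesis
    proof (cases "b = 0")
      case True
      then show ?thesis using a by (simp add: ennreal_divide_zero)
    next
      case b: False
      then have "0 < d" using a False assms by (metis less_le mult_pos_pos mult_zero_right not_less)
      then show ?thesis using a b assms by (simp add: divide_ennreal ennreal_leI field_simps)
    qed
  qed simp
qed

section \<open>Behaviour of the program on an instance\<close>

locale instance_run =
  fixes n :: nat and val :: "value_oracle \<Rightarrow> nat set \<Rightarrow> real" and indep :: "nat set \<Rightarrow> bool"
  assumes indep_empty: "indep {}" and val_nonneg: "A \<subseteq> {..<n} \<Longrightarrow> 0 \<le> val q A"
begin

abbreviation "run \<equiv> wpt n val indep"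
abbreviation "V \<equiv> {..<n}"
abbreviation "f \<equiv> normalize (val Numer)"
abbreviation "g \<equiv> normalize (val Denom)"
definition "\<I> = {A. A \<subseteq> V \<and> indep A}"
abbreviation "rat S \<equiv> ratio (val Numer) (val Denom) S"
abbreviation "outset s \<equiv> bits n (nats s ''out'')"

definition ready :: "state \<Rightarrow> bool" where
  "ready s \<longleftrightarrow> nats s ''n'' 0 = n \<and> (\<forall>e<n. reals s ''fs'' e = f {e} \<and> reals s ''gs'' e = g {e})"

lemma ready_unchanged:
  "unchanged X Y s s' \<Longrightarrow> ''n'' \<notin> X \<Longrightarrow> ''fs'' \<notin> Y \<Longrightarrow> ''gs'' \<notin> Y \<Longrightarrow> ready s \<Longrightarrow> ready s'"
  by (auto simp: ready_def unchanged_def)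

lemma ready_upd [simp]:
  "x \<noteq> ''n'' \<Longrightarrow> ready (nupd x i v s) = ready s"
  "y \<noteq> ''fs'' \<Longrightarrow> y \<noteq> ''gs'' \<Longrightarrow> ready (rupd y i r s) = ready s"
  by (auto simp: ready_def)

definition recorded :: "state \<Rightarrow> bool" where
  "recorded s \<longleftrightarrow> outset s \<in> \<I> \<and> reals s ''fb'' 0 = val Numer (outset s) \<and>
     reals s ''gb'' 0 = val Denom (outset s)"

lemma wpt_pass:
  assumes s: "ready s" "nats s ''x'' 0 = x" "x < n" "nats s ''k'' 0 = k"
    and w: "\<forall>e<n. reals s ''w'' e = w e"
  shows "run (greedy Denom light_test ''w'') s (\<lambda>t s'. t \<le> greedy_time n \<and>
    unchanged greedy_nats (insert ''w'' greedy_reals) s s' \<and>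
    (\<exists>xs. greedy_run V g (\<lambda>_. light (g {x}) g w k) xs \<and>
      (\<forall>e<n. reals s' ''w'' e = reweight (g {x}) g xs w e)))"
proof -
  have "run (greedy Denom light_test ''w'') s (\<lambda>t s'. t \<le> greedy_time n \<and>
    unchanged greedy_nats (insert ''w'' greedy_reals) s s' \<and>
    (\<exists>xs. greedy_run V g (\<lambda>_. light (g {x}) g w k) xs \<and> bits n (nats s' ''S'') = set xs \<and>
      (\<forall>e<n. reals s' ''w'' e = reweight (reals s ''gs'' (nats s ''x'' 0)) g xs (reals s ''w'') e)))"
  proof (rule wpt_greedy)
    fix s' A e assume e: "e < n" "nats s' ''e'' 0 = e"
      and u: "unchanged greedy_nats (insert ''w'' greedy_reals) s s'"
      and we: "reals s' ''w'' e = reals s ''w'' e"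
    have "nats s' ''x'' 0 = x" "nats s' ''k'' 0 = k" "reals s' ''gs'' = reals s ''gs''"
      using s unchangedD(1)[OF u, of "''x''"] unchangedD(1)[OF u, of "''k''"]
        unchangedD(2)[OF u, of "''gs''"] by auto
    then show "bval light_test s' = light (g {x}) g w k e"
      using e we w s by (auto simp: light_test_def light_def ready_def)
  qed (use s in \<open>auto simp: ready_def\<close>)
  then show ?thesis by (rule wpt_mono) (use s w in \<open>auto simp: ready_def reweight_def\<close>)
qed

lemma wpt_round:
  assumes s: "ready s" "nats s ''x'' 0 = x" "x < n"
    and w: "\<forall>e<n. reals s ''w'' e = w e"
  shows "run doubling_round s (\<lambda>t s'. t \<le> round_time n \<and>
    (unchanged (insert ''k'' greedy_nats) (insert ''w'' greedy_reals) s s' \<and>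
    (\<exists>w'. passes V g (g {x}) (scales n) w w' \<and> (\<forall>e<n. reals s' ''w'' e = w' e))))"
proof -
  let ?unch = "unchanged (insert ''k'' greedy_nats) (insert ''w'' greedy_reals)"
  let ?Inv = "\<lambda>j s'. ?unch s s' \<and> nats s' ''k'' 0 = 2 ^ j \<and>
    (\<exists>w'. passes V g (g {x}) j w w' \<and> (\<forall>e<n. reals s' ''w'' e = w' e))"
  have un: "ready s'" "nats s' ''n'' 0 = n" "nats s' ''x'' 0 = x" if "?unch s s'" for s'
    using ready_unchanged[OF that] unchangedD(1)[OF that, of "''x''"] s by (auto simp: ready_def)
  have "run (While (NLess (nvar ''k'') (NAdd (nvar ''n'') (nvar ''n'')))
       (Seq (greedy Denom light_test ''w'')
         (NAssign ''k'' (NConst 0) (NAdd (nvar ''k'') (nvar ''k''))))) (nupd ''k'' 0 1 s)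
    (\<lambda>t s'. t \<le> 1 + scales n * ((greedy_time n + 1) + 1) \<and> ?Inv (scales n) s')"
  proof (rule wpt_While[where Inv = ?Inv])
    fix j s' assume "?Inv j s'"
    then show "bval (NLess (nvar ''k'') (NAdd (nvar ''n'') (nvar ''n''))) s' \<longleftrightarrow> j < scales n"
      by (auto simp: un less_scales_iff)
  next
    show "?Inv 0 (nupd ''k'' 0 1 s)" using w by (auto intro: passes.zero)
  next
    fix j s1 assume "?Inv j s1"
    then obtain w1 where s1: "?unch s s1" "nats s1 ''k'' 0 = 2 ^ j" 
      and w1: "passes V g (g {x}) j w w1" "\<forall>e<n. reals s1 ''w'' e = w1 e" by blast
    show "run (Seq (greedy Denom light_test ''w'')
         (NAssign ''k'' (NConst 0) (NAdd (nvar ''k'') (nvar ''k'')))) s1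
      (\<lambda>t s'. t \<le> greedy_time n + 1 \<and> ?Inv (Suc j) s')"
      unfolding wpt_Seq
    proof (rule wpt_mono[OF wpt_pass[OF un(1)[OF s1(1)] un(3)[OF s1(1)] s(3) s1(2) w1(2)]])
      fix t s2
      assume a: "t \<le> greedy_time n \<and> unchanged greedy_nats (insert ''w'' greedy_reals) s1 s2 \<and>
        (\<exists>xs. greedy_run V g (\<lambda>_. light (g {x}) g w1 (real (2 ^ j))) xs \<and>
          (\<forall>e<n. reals s2 ''w'' e = reweight (g {x}) g xs w1 e))"
      then obtain xs where xs: "greedy_run V g (\<lambda>_. light (g {x}) g w1 (2 ^ j)) xs"
          "\<forall>e<n. reals s2 ''w'' e = reweight (g {x}) g xs w1 e" by auto
      have u: "unchanged greedy_nats (insert ''w'' greedy_reals) s1 s2" using a by blast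
      have k: "nats s2 ''k'' 0 = 2 ^ j" using s1 unchangedD(1)[OF u, of "''k''"] by simp
      have "?unch s s2"
        using unchanged_trans[OF s1(1) u, of "insert ''k'' greedy_nats" "insert ''w'' greedy_reals"] by simp
      then show "run (NAssign ''k'' (NConst 0) (NAdd (nvar ''k'') (nvar ''k''))) s2
        (\<lambda>t' s'. t + t' \<le> greedy_time n + 1 \<and> ?Inv (Suc j) s')"
        using a k passes.Suc[OF w1(1) xs(1)] xs(2) by auto
    qed
  qed
  \<comment> \<open>The estimate \<open>scales n <= 2 * n\<close> replaces the number of passes by
    the polynomial bound in \<open>round_time\<close>.\<close>
  moreover have "1 + (1 + scales n * ((greedy_time n + 1) + 1)) \<le> round_time n"
    using mult_right_mono[OF scales_le[of n], of "greedy_time n + 2"] by (simp add: round_time_def)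
  ultimately show ?thesis
    unfolding doubling_round_def wpt_Seq wpt_NAssign by (auto elim!: wpt_mono)
qed

lemma wpt_weigh:
  assumes s: "ready s" "nats s ''x'' 0 = x" "x < n"
  shows "run weigh s (\<lambda>t s'. t \<le> weigh_time n \<and>
    (unchanged ({''k'', ''t''} \<union> greedy_nats) (insert ''w'' greedy_reals) s s' \<and>
    (\<exists>w. rounds V g (g {x}) (scales n) n w \<and> (\<forall>e<n. reals s' ''w'' e = w e))))"
proof -
  let ?unch = "unchanged ({''k'', ''t''} \<union> greedy_nats) (insert ''w'' greedy_reals)"
  have un: "ready s'" "nats s' ''n'' 0 = n" "nats s' ''x'' 0 = x" if "?unch s s'" for s'
    using ready_unchanged[OF that] unchangedD(1)[OF that, of "''x''"] s by (auto simp: ready_def)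
  have clear: "run (For ''e'' (nvar ''n'') (RAssign ''w'' (nvar ''e'') (RNat (NConst 1)))) s
    (\<lambda>t s'. t \<le> 2 + n * (1 + 2) \<and> (?unch s s' \<and> (\<forall>e<n. reals s' ''w'' e = 1)))"
    by (rule wpt_For[where Inv = "\<lambda>k s'. ?unch s s' \<and> (\<forall>e<k. reals s' ''w'' e = 1)"])
      (auto simp: un less_Suc_eq)
  let ?Inv = "\<lambda>k s'. ?unch s s' \<and>
    (\<exists>w. rounds V g (g {x}) (scales n) k w \<and> (\<forall>e<n. reals s' ''w'' e = w e))"
  have loop: "run (For ''t'' (nvar ''n'') doubling_round) s1
    (\<lambda>t s'. t \<le> 2 + n * (round_time n + 2) \<and> ?Inv n s')"
    if s1: "?unch s s1" "\<forall>e<n. reals s1 ''w'' e = 1" for s1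
  proof (rule wpt_For[where Inv = ?Inv])
    show "?Inv 0 (nupd ''t'' 0 0 s1)" using s1 by (auto intro!: exI[of _ "\<lambda>_. 1"] rounds.zero)
  next
    fix k s2 assume k: "nats s2 ''t'' 0 = k" and "?Inv k s2"
    then obtain w where s2: "?unch s s2" and
      w: "rounds V g (g {x}) (scales n) k w" "\<forall>e<n. reals s2 ''w'' e = w e" by blast
    show "run doubling_round s2 (\<lambda>t s'. t \<le> round_time n \<and> nats s' ''t'' 0 = k \<and> ?Inv (Suc k) (nupd ''t'' 0 (Suc k) s'))"
    proof (rule wpt_mono[OF wpt_round[OF un(1)[OF s2] un(3)[OF s2] s(3) w(2)]], elim conjE exE, intro conjI)
      fix t s3 w'
      assume u: "unchanged (insert ''k'' greedy_nats) (insert ''w'' greedy_reals) s2 s3"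
        and w': "passes V g (g {x}) (scales n) w w'" "\<forall>e<n. reals s3 ''w'' e = w' e"
      show "nats s3 ''t'' 0 = k" using unchangedD(1)[OF u, of "''t''"] k by simp
      show "?unch s (nupd ''t'' 0 (Suc k) s3)" 
        using unchanged_trans[OF s2 u, of "{''k'', ''t''} \<union> greedy_nats" "insert ''w'' greedy_reals"] by simp
      show "\<exists>w. rounds V g (g {x}) (scales n) (Suc k) w \<and>
          (\<forall>e<n. reals (nupd ''t'' 0 (Suc k) s3) ''w'' e = w e)"
        using rounds.Suc[OF w(1) w'(1)] w'(2) by auto
    qed
  qed (auto simp: un)
  show ?thesis unfolding weigh_def wpt_Seq
    by (rule wpt_mono[OF clear], rule wpt_mono[OF loop]) (auto simp: weigh_time_def)
qed

lemma wpt_candidate: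
  assumes s: "ready s" "nats s ''x'' 0 = x" "x < n" "reals s ''l'' 0 = l"
    and w: "\<forall>e<n. reals s ''w'' e = w e"
  shows "run (greedy Numer dense_test ''z'') s (\<lambda>t s'. t \<le> greedy_time n \<and>
    unchanged greedy_nats (insert ''z'' greedy_reals) s s' \<and>
    (\<exists>xs. greedy_run V f (dense f g \<I> w (g {x}) l) xs \<and> bits n (nats s' ''S'') = set xs \<and> set xs \<in> \<I>))"
proof -
  have "run (greedy Numer dense_test ''z'') s (\<lambda>t s'. t \<le> greedy_time n \<and>
    unchanged greedy_nats (insert ''z'' greedy_reals) s s' \<and>
    (\<exists>xs. greedy_run V f (dense f g \<I> w (g {x}) l) xs \<and> bits n (nats s' ''S'') = set xs \<and>
      (\<forall>e<n. reals s' ''z'' e = reweight (reals s ''gs'' (nats s ''x'' 0)) f xs (reals s ''z'') e)))"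
  proof (rule wpt_greedy)
    fix s' A e assume e: "e < n" "nats s' ''e'' 0 = e" and A: "A \<subseteq> V"
      and ind: "nats s' ''ind'' 0 = (if indep (insert e A) then 1 else 0)"
      and v: "reals s' ''v'' 0 = f (insert e A)" "reals s' ''cur'' 0 = f A"
      and u: "unchanged greedy_nats (insert ''z'' greedy_reals) s s'"
    have "nats s' ''x'' 0 = x" "reals s' ''gs'' = reals s ''gs''" "reals s' ''w'' = reals s ''w''" "reals s' ''l'' 0 = l"
      using s unchangedD(1)[OF u, of "''x''"] unchangedD(2)[OF u, of "''gs''"] 
        unchangedD(2)[OF u, of "''w''"] unchangedD(2)[OF u, of "''l''"] by auto
    then show "bval dense_test s' = dense f g \<I> w (g {x}) l A e"
      using e ind v w s A by (auto simp: dense_test_def dense_def ready_def \<I>_def)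
  qed (use s in \<open>auto simp: ready_def\<close>)
  moreover have "set xs \<in> \<I>" if "greedy_path V f (dense f g \<I> w (g {x}) l) xs" for xs
    using that by (induction rule: greedy_path.induct) (auto simp: dense_def \<I>_def indep_empty)
  ultimately show ?thesis by (auto elim!: wpt_mono simp: greedy_run_def)
qed

lemma wpt_compare:
  assumes s: "ready s" "recorded s" and S: "bits n (nats s ''S'') = S" "S \<in> \<I>"
  shows "run compare s (\<lambda>t s'. t \<le> compare_time n \<and>
    unchanged {''e'', ''out''} {''fc'', ''gc'', ''fb'', ''gb''} s s' \<and> recorded s' \<and>
    rat (outset s) \<le> rat (outset s') \<and> rat S \<le> rat (outset s'))"
proof -
  define s1 where "s1 = rupd ''gc'' 0 (val Denom S) (rupd ''fc'' 0 (val Numer S) s)"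
  have fg: "reals s ''fb'' 0 = val Numer (outset s)" "reals s ''gb'' 0 = val Denom (outset s)"
    and out: "outset s \<in> \<I>" using s by (auto simp: recorded_def)
  have nn: "0 \<le> val q (outset s)" "0 \<le> val q S" for q
    using out S by (auto simp: \<I>_def intro: val_nonneg)
  let ?b = "val Numer (outset s) * val Denom S < val Numer S * val Denom (outset s) \<or>
      \<not> 0 < val Numer (outset s) \<and> 0 < val Numer S"
  have b: "bval better s1 \<longleftrightarrow> ?b" using fg by (auto simp: better_def s1_def)
  have step: "run compare s Q \<longleftrightarrow> run (Cond better
       (Seq (RAssign ''fb'' (NConst 0) (rvar ''fc''))
       (Seq (RAssign ''gb'' (NConst 0) (rvar ''gc''))
         (For ''e'' (nvar ''n'') (NAssign ''out'' (nvar ''e'') (NAt ''S'' (nvar ''e''))))))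
       Skip) s1 (\<lambda>t s'. Q (1 + (1 + t)) s')" for Q
    using S by (simp add: compare_def s1_def)
  show ?thesis
  proof (cases ?b)
    case True
    define s2 where "s2 = rupd ''gb'' 0 (val Denom S) (rupd ''fb'' 0 (val Numer S) s1)"
    let ?unch = "unchanged {''e'', ''out''} {''fc'', ''gc'', ''fb'', ''gb''}"
    let ?Inv = "\<lambda>k s'. ?unch s s' \<and> reals s' = reals s2 \<and> nats s' ''S'' = nats s ''S'' \<and> (\<forall>e<k. nats s' ''out'' e = nats s ''S'' e)"
    have un: "nats s' ''n'' 0 = n" if "?unch s s'" for s'
      using unchangedD(1)[OF that, of "''n''"] s by (auto simp: ready_def)
    have copy: "run (For ''e'' (nvar ''n'') (NAssign ''out'' (nvar ''e'') (NAt ''S'' (nvar ''e'')))) s2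
      (\<lambda>t s'. t \<le> 2 + n * (1 + 2) \<and> ?Inv n s')"
      by (rule wpt_For[where Inv = ?Inv]) (auto simp: un s2_def s1_def less_Suc_eq)
    have "run compare s (\<lambda>t s'. t \<le> compare_time n \<and> ?Inv n s')"
    proof -
      have "run (Seq (RAssign ''fb'' (NConst 0) (rvar ''fc''))
       (Seq (RAssign ''gb'' (NConst 0) (rvar ''gc''))
         (For ''e'' (nvar ''n'') (NAssign ''out'' (nvar ''e'') (NAt ''S'' (nvar ''e'')))))) s1 Q \<longleftrightarrow>
         run (For ''e'' (nvar ''n'') (NAssign ''out'' (nvar ''e'') (NAt ''S'' (nvar ''e'')))) s2 (\<lambda>t. Q (1 + (1 + t)))" for Q
        by (simp add: s2_def s1_def)
      then show ?thesis unfolding step wpt_Cond[of _ _ _ better] using b True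
        by (simp del: wpt_simps) (rule wpt_mono[OF copy], auto simp: compare_time_def)
    qed
    then show ?thesis
    proof (rule wpt_mono, elim conjE, intro conjI)
      fix t :: nat and s' :: state assume r: "reals s' = reals s2" and o: "\<forall>e<n. nats s' ''out'' e = nats s ''S'' e"
      have os: "outset s' = S" using S o by (auto simp: bits_def)
      then show "recorded s'" using S r by (simp add: recorded_def s2_def)
      show "rat (outset s) \<le> rat (outset s')"
        unfolding os ratio_def using nn True by (intro ratio_compare(1)) auto
      show "rat S \<le> rat (outset s')" by (simp add: os)
    qed
  next
    case False
    then have "rat S \<le> rat (outset s)"
      unfolding ratio_def using nn by (intro ratio_compare(2)) auto
    then show ?thesis unfolding step using b False s
      by (simp add: s1_def recorded_def compare_time_def)
  qed
qed

text \<open>For each density, some greedy run does no better than \<open>S\<close>; the witness is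
  the run that was executed. One run suffices, because \<open>good_candidate\<close> speaks of all
  runs.\<close>

definition beaten :: "nat \<Rightarrow> (nat \<Rightarrow> real) \<Rightarrow> nat \<Rightarrow> nat \<Rightarrow> nat set \<Rightarrow> bool" where
  "beaten x w y m S \<longleftrightarrow>
     (\<forall>i<m. \<exists>xs. greedy_run V f (dense f g \<I> w (g {x}) (f {y} / w y / 2 ^ i)) xs \<and> rat (set xs) \<le> rat S)"

lemma beaten_mono: "beaten x w y m S \<Longrightarrow> rat S \<le> rat S' \<Longrightarrow> beaten x w y m S'"
  unfolding beaten_def by (blast intro: order_trans[of _ "rat S"])

abbreviation density_nats :: "vname set" where
  "density_nats \<equiv> {''i'', ''out''} \<union> greedy_nats"
abbreviation density_reals :: "vname set" where
  "density_reals \<equiv> {''l'', ''z'', ''fc'', ''gc'', ''fb'', ''gb''} \<union> greedy_reals"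

lemma wpt_densities:
  assumes s: "ready s" "recorded s" "nats s ''x'' 0 = x" "x < n" "nats s ''y'' 0 = y" "y < n"
    and w: "\<forall>e<n. reals s ''w'' e = w e"
  shows "run try_densities s (\<lambda>t s'. t \<le> densities_time n \<and>
    unchanged density_nats density_reals s s' \<and> recorded s' \<and>
    rat (outset s) \<le> rat (outset s') \<and> beaten x w y (3 * n + 4) (outset s'))"
proof -
  let ?unch = "unchanged density_nats density_reals"
  let ?Inv = "\<lambda>k s'. ?unch s s' \<and> recorded s' \<and> rat (outset s) \<le> rat (outset s') \<and>
    reals s' ''l'' 0 = f {y} / w y / 2 ^ k \<and> beaten x w y k (outset s')"
  have un: "ready s'" "nats s' ''n'' 0 = n" "nats s' ''x'' 0 = x" "\<forall>e<n. reals s' ''w'' e = w e"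
    if "?unch s s'" for s'
    using ready_unchanged[OF that] unchangedD(1)[OF that, of "''x''"] unchangedD(2)[OF that, of "''w''"] s w
    by (auto simp: ready_def)
  define s1 where "s1 = rupd ''l'' 0 (f {y} / w y) s"
  let ?body = "Seq (greedy Numer dense_test ''z'')
       (Seq compare
         (RAssign ''l'' (NConst 0) (RDiv (rvar ''l'') (RNat (NConst 2)))))"
  have loop: "run (For ''i'' (NAdd (nvar ''n'') (NAdd (nvar ''n'') (NAdd (nvar ''n'') (NConst 4)))) ?body) s1
    (\<lambda>t s'. t \<le> 2 + (3 * n + 4) * ((greedy_time n + compare_time n + 1) + 2) \<and> ?Inv (3 * n + 4) s')"
  proof (rule wpt_For[where Inv = ?Inv])
    show "?Inv 0 (nupd ''i'' 0 0 s1)"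
      using s by (simp add: s1_def beaten_def recorded_def)
  next
    fix k s' assume "?Inv k s'"
    then show "nval (NAdd (nvar ''n'') (NAdd (nvar ''n'') (NAdd (nvar ''n'') (NConst 4)))) s' = 3 * n + 4"
      by (simp add: un)
  next
    fix k s2 assume k: "nats s2 ''i'' 0 = k" and inv: "?Inv k s2"
    have u2: "?unch s s2" and r2: "recorded s2" and l2: "reals s2 ''l'' 0 = f {y} / w y / 2 ^ k"
      using inv by auto
    have fin: "run (Seq compare (RAssign ''l'' (NConst 0) (RDiv (rvar ''l'') (RNat (NConst 2))))) s3
      (\<lambda>t s'. t \<le> compare_time n + 1 \<and> nats s' ''i'' 0 = k \<and> ?Inv (Suc k) (nupd ''i'' 0 (Suc k) s'))"
      if u3: "unchanged greedy_nats (insert ''z'' greedy_reals) s2 s3"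
        and xs: "greedy_run V f (dense f g \<I> w (g {x}) (f {y} / w y / 2 ^ k)) xs"
          "bits n (nats s3 ''S'') = set xs" "set xs \<in> \<I>" for s3 xs
    proof -
      have us3: "?unch s s3" using unchanged_trans[OF u2 u3, of density_nats density_reals] by simp
      have o3: "nats s3 ''out'' = nats s2 ''out''" using unchangedD(1)[OF u3, of "''out''"] by simp
      have r3: "recorded s3" using r2 o3 unchangedD(2)[OF u3, of "''fb''"] unchangedD(2)[OF u3, of "''gb''"]
        by (simp add: recorded_def)
      show ?thesis unfolding wpt_Seq
      proof (rule wpt_mono[OF wpt_compare[OF un(1)[OF us3] r3 xs(2,3)]])
        fix t s4
        assume a: "t \<le> compare_time n \<and> unchanged {''e'', ''out''} {''fc'', ''gc'', ''fb'', ''gb''} s3 s4 \<and>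
          recorded s4 \<and> rat (outset s3) \<le> rat (outset s4) \<and> rat (set xs) \<le> rat (outset s4)"
        then have u4: "unchanged {''e'', ''out''} {''fc'', ''gc'', ''fb'', ''gb''} s3 s4" by simp
        have us4: "?unch s s4" using unchanged_trans[OF us3 u4, of density_nats density_reals] by simp
        have i4: "nats s4 ''i'' 0 = k"
          using unchangedD(1)[OF u4, of "''i''"] unchangedD(1)[OF u3, of "''i''"] k by simp
        have l4: "reals s4 ''l'' 0 = f {y} / w y / 2 ^ k"
          using unchangedD(2)[OF u4, of "''l''"] unchangedD(2)[OF u3, of "''l''"] l2 by simp
        have r24: "rat (outset s2) \<le> rat (outset s4)" using a o3 by simp
        then have "beaten x w y k (outset s4)" using inv beaten_mono by blast
        \<comment> \<open>The run just executed is the new witness. The old witnesses survive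
          because the recorded ratio never decreases.\<close>
        then have "beaten x w y (Suc k) (outset s4)"
          using xs(1) a unfolding beaten_def by (auto simp: less_Suc_eq)
        moreover have "rat (outset s) \<le> rat (outset s4)" using r24 inv order_trans by blast
        ultimately show "run (RAssign ''l'' (NConst 0) (RDiv (rvar ''l'') (RNat (NConst 2)))) s4
          (\<lambda>t' s'. t + t' \<le> compare_time n + 1 \<and> nats s' ''i'' 0 = k \<and> ?Inv (Suc k) (nupd ''i'' 0 (Suc k) s'))"
          using a us4 i4 l4 by (simp add: recorded_def mult.commute)
      qed
    qed
    show "run ?body s2 (\<lambda>t s'. t \<le> greedy_time n + compare_time n + 1 \<and> nats s' ''i'' 0 = k \<and>
        ?Inv (Suc k) (nupd ''i'' 0 (Suc k) s'))"
      unfolding wpt_Seq[of _ _ _ "greedy Numer dense_test ''z''"]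
    proof (rule wpt_mono[OF wpt_candidate[OF un(1)[OF u2] un(3)[OF u2] s(4) l2 un(4)[OF u2]]], elim conjE exE)
      fix t s3 xs
      assume t: "t \<le> greedy_time n" and u3: "unchanged greedy_nats (insert ''z'' greedy_reals) s2 s3"
        and xs: "greedy_run V f (dense f g \<I> w (g {x}) (f {y} / w y / 2 ^ k)) xs"
          "bits n (nats s3 ''S'') = set xs" "set xs \<in> \<I>"
      show "run (Seq compare (RAssign ''l'' (NConst 0) (RDiv (rvar ''l'') (RNat (NConst 2))))) s3
        (\<lambda>t' s'. t + t' \<le> greedy_time n + compare_time n + 1 \<and> nats s' ''i'' 0 = k \<and>
          ?Inv (Suc k) (nupd ''i'' 0 (Suc k) s'))"
        by (rule wpt_mono[OF fin[OF u3 xs]]) (use t in simp)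
    qed
  qed
  have "rval (RDiv (RAt ''fs'' (nvar ''y'')) (RAt ''w'' (nvar ''y''))) s = f {y} / w y"
    using s w by (simp add: ready_def)
  then have s1: "rupd ''l'' (nval (NConst 0) s) (rval (RDiv (RAt ''fs'' (nvar ''y'')) (RAt ''w'' (nvar ''y''))) s) s = s1"
    by (simp add: s1_def)
  show ?thesis unfolding try_densities_def wpt_Seq[of _ _ _ "RAssign _ _ _"] wpt_RAssign s1
    by (rule wpt_mono[OF loop]) (auto simp: densities_time_def algebra_simps)
qed

definition settled :: "nat \<Rightarrow> nat set \<Rightarrow> bool" where
  "settled x S \<longleftrightarrow> (\<exists>w. rounds V g (g {x}) (scales n) n w \<and> (\<forall>y<n. beaten x w y (3 * n + 4) S))"

lemma settled_mono: "settled x S \<Longrightarrow> rat S \<le> rat S' \<Longrightarrow> settled x S'"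
  unfolding settled_def by (meson beaten_mono)

lemma wpt_candidates:
  assumes s: "ready s" "recorded s" "nats s ''x'' 0 = x" "x < n"
  shows "run (Seq weigh (For ''y'' (nvar ''n'') try_densities)) s (\<lambda>t s'.
    t \<le> weigh_time n + (2 + n * (densities_time n + 2)) \<and>
    ready s' \<and> nats s' ''x'' 0 = x \<and> recorded s' \<and>
    rat (outset s) \<le> rat (outset s') \<and> settled x (outset s'))"
  unfolding wpt_Seq
proof (rule wpt_mono[OF wpt_weigh[OF s(1,3,4)]], elim conjE exE)
  fix t1 s1 w
  assume t1: "t1 \<le> weigh_time n"
    and u: "unchanged ({''k'', ''t''} \<union> greedy_nats) (insert ''w'' greedy_reals) s s1"
    and w: "rounds V g (g {x}) (scales n) n w" "\<forall>e<n. reals s1 ''w'' e = w e"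
  have o1: "nats s1 ''out'' = nats s ''out''" using unchangedD(1)[OF u, of "''out''"] by simp
  have s1: "ready s1" "nats s1 ''x'' 0 = x" "recorded s1"
    using ready_unchanged[OF u] unchangedD(1)[OF u, of "''x''"] o1 s
      unchangedD(2)[OF u, of "''fb''"] unchangedD(2)[OF u, of "''gb''"]
    by (auto simp: recorded_def)
  let ?Inv = "\<lambda>k s'. (ready s' \<and> nats s' ''x'' 0 = x \<and> recorded s' \<and> (\<forall>e<n. reals s' ''w'' e = w e)) \<and>
    rat (outset s) \<le> rat (outset s') \<and> (\<forall>y<k. beaten x w y (3 * n + 4) (outset s'))"
  have "run (For ''y'' (nvar ''n'') try_densities) s1
    (\<lambda>t s'. t \<le> 2 + n * (densities_time n + 2) \<and> ?Inv n s')"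
  proof (rule wpt_For[where Inv = ?Inv])
    show "?Inv 0 (nupd ''y'' 0 0 s1)" using s1 w o1 by (simp add: recorded_def)
  next
    fix k s' assume "?Inv k s'"
    then show "nval (nvar ''n'') s' = n" by (simp add: ready_def)
  next
    fix k s2 assume k: "k < n" "nats s2 ''y'' 0 = k" and inv: "?Inv k s2"
    show "run try_densities s2 (\<lambda>t s'. t \<le> densities_time n \<and> nats s' ''y'' 0 = k \<and>
      ?Inv (Suc k) (nupd ''y'' 0 (Suc k) s'))"
    proof (rule wpt_mono[OF wpt_densities[of s2 x k w]])
      fix t s3
      assume a: "t \<le> densities_time n \<and> unchanged density_nats density_reals s2 s3 \<and> recorded s3 \<and>
        rat (outset s2) \<le> rat (outset s3) \<and> beaten x w k (3 * n + 4) (outset s3)"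
      then have u3: "unchanged density_nats density_reals s2 s3" by simp
      have "ready s3" "nats s3 ''x'' 0 = x" "nats s3 ''y'' 0 = k" "\<forall>e<n. reals s3 ''w'' e = w e"
        using ready_unchanged[OF u3] unchangedD(1)[OF u3, of "''x''"] unchangedD(1)[OF u3, of "''y''"]
          unchangedD(2)[OF u3, of "''w''"] inv k by auto
      moreover have "rat (outset s) \<le> rat (outset s3)" using a inv order_trans by blast
      moreover have "beaten x w y (3 * n + 4) (outset s3)" if "y < Suc k" for y
        using that a inv beaten_mono by (auto simp: less_Suc_eq)
      ultimately show "t \<le> densities_time n \<and> nats s3 ''y'' 0 = k \<and> ?Inv (Suc k) (nupd ''y'' 0 (Suc k) s3)"
        using a by (simp add: recorded_def)
    qed (use inv k s in auto)
  qed
  then show "run (For ''y'' (nvar ''n'') try_densities) s1 (\<lambda>t' s'.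
    t1 + t' \<le> weigh_time n + (2 + n * (densities_time n + 2)) \<and>
    ready s' \<and> nats s' ''x'' 0 = x \<and> recorded s' \<and>
    rat (outset s) \<le> rat (outset s') \<and> settled x (outset s'))"
    by (rule wpt_mono) (use t1 w in \<open>auto simp: settled_def\<close>)
qed

lemma wpt_program:
  "run program (init n) (\<lambda>t s'. t \<le> program_time n \<and> outset s' \<in> \<I> \<and>
    rat {} \<le> rat (outset s') \<and> (\<forall>x<n. settled x (outset s')))"
proof -
  \<comment> \<open>The array \<open>out\<close> is still zero, so the first two queries record the
    empty set as the initial candidate.\<close>
  define s0 where "s0 = rupd ''gb'' 0 (val Denom {}) (rupd ''fb'' 0 (val Numer {}) (init n))"
  have bits0: "bits n (\<lambda>_. 0) = {}" by (simp add: bits_def)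
  have init: "nats (init n) = (\<lambda>_ _. 0)(''n'' := (\<lambda>_. 0)(0 := n))" "reals (init n) = (\<lambda>_ _. 0)"
    by (simp_all add: init_def)
  \<comment> \<open>The set array is empty between iterations, so each query concerns a singleton,
    where \<open>normalize\<close> changes nothing.\<close>
  let ?I1 = "\<lambda>k s. nats s ''n'' 0 = n \<and> bits n (nats s ''S'') = {} \<and> nats s ''out'' = (\<lambda>_. 0) \<and>
    reals s ''fb'' 0 = val Numer {} \<and> reals s ''gb'' 0 = val Denom {} \<and>
    (\<forall>e<k. reals s ''fs'' e = f {e} \<and> reals s ''gs'' e = g {e})"
  have singles: "run singletons s0 (\<lambda>t s. t \<le> 2 + n * (4 + 2) \<and> ?I1 n s)"
    unfolding singletons_def
    by (rule wpt_For[where Inv = ?I1]) (auto simp: s0_def init bits0 normalize_def less_Suc_eq)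
  let ?I2 = "\<lambda>k s. ready s \<and> recorded s \<and> rat {} \<le> rat (outset s) \<and> (\<forall>x<k. settled x (outset s))"
  have loop: "run (For ''x'' (nvar ''n'') (Seq weigh (For ''y'' (nvar ''n'') try_densities))) s1
    (\<lambda>t s. t \<le> 2 + n * (weigh_time n + (2 + n * (densities_time n + 2)) + 2) \<and> ?I2 n s)"
    if s1: "?I1 n s1" for s1
  proof (rule wpt_For[where Inv = ?I2])
    show "?I2 0 (nupd ''x'' 0 0 s1)"
      using s1 indep_empty by (simp add: ready_def recorded_def bits0 \<I>_def)
  next
    fix k s' assume "?I2 k s'"
    then show "nval (nvar ''n'') s' = n" by (simp add: ready_def)
  next
    fix k s2 assume k: "k < n" "nats s2 ''x'' 0 = k" and inv: "?I2 k s2"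
    show "run (Seq weigh (For ''y'' (nvar ''n'') try_densities)) s2 (\<lambda>t s'.
      t \<le> weigh_time n + (2 + n * (densities_time n + 2)) \<and> nats s' ''x'' 0 = k \<and>
      ?I2 (Suc k) (nupd ''x'' 0 (Suc k) s'))"
    proof (rule wpt_mono[OF wpt_candidates[of s2 k]])
      fix t s3
      assume a: "t \<le> weigh_time n + (2 + n * (densities_time n + 2)) \<and> ready s3 \<and>
        nats s3 ''x'' 0 = k \<and> recorded s3 \<and> rat (outset s2) \<le> rat (outset s3) \<and> settled k (outset s3)"
      have "rat {} \<le> rat (outset s3)" using a inv order_trans by blast
      moreover have "settled x (outset s3)" if "x < Suc k" for x
        using that a inv settled_mono by (auto simp: less_Suc_eq)
      ultimately show "t \<le> weigh_time n + (2 + n * (densities_time n + 2)) \<and> nats s3 ''x'' 0 = k \<and>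
        ?I2 (Suc k) (nupd ''x'' 0 (Suc k) s3)"
        using a by (simp add: recorded_def)
    qed (use inv k in auto)
  qed
  have step: "run program (init n) Q \<longleftrightarrow> run (Seq singletons
      (For ''x'' (nvar ''n'') (Seq weigh (For ''y'' (nvar ''n'') try_densities)))) s0 (\<lambda>t. Q (1 + (1 + t)))" for Q
    by (simp add: program_def s0_def init bits0)
  show ?thesis unfolding step wpt_Seq[of _ _ _ singletons]
    by (rule wpt_mono[OF singles], rule wpt_mono[OF loop]) (auto simp: program_time_def recorded_def)
qed

end

section \<open>From recorded candidates to the approximation factor\<close>

lemma ratio_le_mult_ratio:
  fixes a b c d r :: real
  assumes "0 < a" "0 \<le> b" "0 < c" "0 \<le> d" "1 \<le> r" and le: "a * d \<le> r * (c * b)"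
  shows "ennreal a / ennreal b \<le> ennreal r * (ennreal c / ennreal d)"
proof (cases "d = 0")
  case True
  then show ?thesis using assms by (simp add: ennreal_divide_zero ennreal_mult_top)
next
  case False
  then have d: "0 < d" using assms by simp
  have "0 < a * d" using assms d by simp
  with le have "b \<noteq> 0" by auto
  then have b: "0 < b" using assms by simp
  have "a / b \<le> r * (c / d)" using le b d by (simp add: field_simps)
  then have "ennreal (a / b) \<le> ennreal (r * (c / d))" by (rule ennreal_leI)
  then show ?thesis using assms b d by (simp add: divide_ennreal ennreal_mult del: times_divide_eq_right)
qed

context instance_run
begin

text \<open>The empty set is covered by the initial candidate, and a set with numerator 0 has ratio
  0. Otherwise \<open>good_candidate\<close> applies: the set it provides has positive
  \<open>f\<close>, hence is nonempty, so the normalized functions agree with the oracles on both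
  sets.\<close>

lemma settled_bound:
  assumes f: "matroid_normalized_submodular V f \<I>" and g: "normalized_submodular V g"
    and settled: "\<And>x. x < n \<Longrightarrow> settled x S" and S: "rat {} \<le> rat S" and X: "X \<in> \<I>"
  shows "rat X \<le> ennreal (ratio_factor n) * rat S"
proof -
  have scale: "b \<le> ennreal (ratio_factor n) * b" for b
    using mult_right_mono[OF ennreal_leI[OF ratio_factor_ge_1[of n]], of b] by simp
  have XV: "X \<subseteq> V" using X by (simp add: \<I>_def)
  consider "X = {}" | "X \<noteq> {}" "val Numer X = 0" | "X \<noteq> {}" "0 < val Numer X"
    using val_nonneg[OF XV, of Numer] by fastforce
  then show ?thesis
  proof cases
    case 1
    then show ?thesis using S scale order_trans by blast
  next
    case 2
    then show ?thesis by (simp add: ratio_def)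
  next
    case 3
    then have "0 < f X" by (simp add: normalize_def)
    from good_candidate[OF f g _ X this, of n] obtain x where x: "x \<in> X"
      and good: "\<And>w. rounds V g (g {x}) (scales n) n w \<Longrightarrow> \<exists>y\<in>X. \<exists>i<3*n+4. \<forall>xs.
        greedy_run V f (dense f g \<I> w (g {x}) (f {y} / w y / 2 ^ i)) xs \<longrightarrow>
        0 < f (set xs) \<and> f X * g (set xs) \<le> ratio_factor n * (f (set xs) * g X)"
      by auto
    from settled[of x] x XV obtain w where w: "rounds V g (g {x}) (scales n) n w"
      and b: "\<And>y. y < n \<Longrightarrow> beaten x w y (3 * n + 4) S" by (auto simp: settled_def)
    from good[OF w] obtain y i where y: "y \<in> X" and i: "i < 3 * n + 4" and
      good': "\<And>xs. greedy_run V f (dense f g \<I> w (g {x}) (f {y} / w y / 2 ^ i)) xs \<Longrightarrow>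
        0 < f (set xs) \<and> f X * g (set xs) \<le> ratio_factor n * (f (set xs) * g X)" by blast
    from b[of y] y i XV obtain xs where
      run: "greedy_run V f (dense f g \<I> w (g {x}) (f {y} / w y / 2 ^ i)) xs" and le: "rat (set xs) \<le> rat S"
      unfolding beaten_def by blast
    note gd = good'[OF run]
    have ne: "set xs \<noteq> {}" using gd by (auto simp: normalize_def)
    have xsV: "set xs \<subseteq> V" using run greedy_path_subset[of V f _ xs] unfolding greedy_run_def by blast
    have "rat X \<le> ennreal (ratio_factor n) * rat (set xs)"
      unfolding ratio_def using gd ne 3 val_nonneg[OF XV] val_nonneg[OF xsV] ratio_factor_ge_1[of n]
      by (intro ratio_le_mult_ratio) (auto simp: normalize_def)
    also have "\<dots> \<le> ennreal (ratio_factor n) * rat S" using le by (intro mult_left_mono) auto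
    finally show ?thesis .
  qed
qed

end

section \<open>Transfer along the numbering of the ground set\<close>

lemma normalized_submodular_pullback:
  assumes en: "bij_betw en V E" and "finite V" "\<forall>S\<subseteq>E. 0 \<le> f S" "mono_on (Pow E) f" "submodular_on E f"
  shows "normalized_submodular V (normalize (\<lambda>A. f (en ` A)))"
proof (rule normalized_submodular_normalize)
  have sub: "en ` A \<subseteq> E" if "A \<subseteq> V" for A using that en by (auto simp: bij_betw_def)
  show "\<forall>S\<subseteq>V. 0 \<le> f (en ` S)" using sub assms(3) by simp
  show "mono_on (Pow V) (\<lambda>A. f (en ` A))"
  proof (rule mono_onI)
    fix A B assume "A \<in> Pow V" "B \<in> Pow V" "A \<le> B"
    then show "f (en ` A) \<le> f (en ` B)"
      using sub[of A] sub[of B] by (intro mono_onD[OF assms(4)] image_mono) auto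
  qed
  show "submodular_on V (\<lambda>A. f (en ` A))"
    unfolding submodular_on_def
  proof (intro allI impI)
    fix S T e assume a: "S \<subseteq> T \<and> T \<subseteq> V \<and> e \<in> V - T"
    then have "en e \<in> E - en ` T"
      using inj_on_image_mem_iff[of en V e T] bij_betw_apply[OF en, of e] bij_betw_imp_inj_on[OF en] by blast
    moreover have "en ` S \<subseteq> en ` T" using a by blast
    ultimately have "f (en ` T \<union> {en e}) - f (en ` T) \<le> f (en ` S \<union> {en e}) - f (en ` S)"
      using assms(5)[unfolded submodular_on_def, rule_format, of "en ` S" "en ` T" "en e"] sub[of T] a by simp
    then show "f (en ` (T \<union> {e})) - f (en ` T) \<le> f (en ` (S \<union> {e})) - f (en ` S)" by simp
  qed
qed (fact \<open>finite V\<close>)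

lemma matroid_pullback:
  assumes en: "bij_betw en V E" and V: "finite V" and "matroid E \<I>"
  shows "matroid V {A. A \<subseteq> V \<and> en ` A \<in> \<I>}"
proof -
  interpret matroid E \<I> by (rule assms(3))
  have inj: "inj_on en V" using en by (simp add: bij_betw_def)
  show ?thesis
  proof
    fix A B assume "A \<subseteq> B" "B \<in> {A. A \<subseteq> V \<and> en ` A \<in> \<I>}"
    then show "A \<in> {A. A \<subseteq> V \<and> en ` A \<in> \<I>}"
      using indep_subset[of "en ` A" "en ` B"] by (auto simp: image_mono)
  next
    fix A B assume A: "A \<in> {A. A \<subseteq> V \<and> en ` A \<in> \<I>}" and B: "B \<in> {A. A \<subseteq> V \<and> en ` A \<in> \<I>}"
      and less: "card A < card B"
    have "card (en ` A) = card A" "card (en ` B) = card B"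
      using A B inj by (auto intro!: card_image inj_on_subset[OF inj])
    then obtain z where z: "z \<in> en ` B - en ` A" "insert z (en ` A) \<in> \<I>"
      using exchange[of "en ` A" "en ` B"] A B less by auto
    then obtain x where "x \<in> B" "z = en x" by blast
    then show "\<exists>x\<in>B - A. insert x A \<in> {A. A \<subseteq> V \<and> en ` A \<in> \<I>}"
      using z A B by (intro bexI[of _ x]) auto
  qed (use V empty_indep in auto)
qed

theorem theorem6:
  "\<exists>(c :: com) (\<alpha> :: nat \<Rightarrow> real) (p :: nat poly).
     \<alpha> \<in> O(\<lambda>n. sqrt (real n) * ln (real n)) \<and>
     (\<forall>(n :: nat) (E :: 'a set) (en :: nat \<Rightarrow> 'a) (f :: 'a set \<Rightarrow> real) (g :: 'a set \<Rightarrow> real) (\<I> :: 'a set set).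
        finite E \<longrightarrow> card E = n \<longrightarrow> bij_betw en {..<n} E \<longrightarrow>
        (\<forall>S \<subseteq> E. f S \<ge> 0) \<longrightarrow> mono_on (Pow E) f \<longrightarrow> submodular_on E f \<longrightarrow>
        (\<forall>S \<subseteq> E. g S \<ge> 0) \<longrightarrow> mono_on (Pow E) g \<longrightarrow> submodular_on E g \<longrightarrow>
        matroid E \<I> \<longrightarrow>
        (\<exists>t S. computes_in c E en f g \<I> t S \<and> t \<le> poly p n \<and> S \<in> \<I> \<and>
               (MAX T\<in>\<I>. ratio f g T) \<le> ennreal (\<alpha> n) * ratio f g S))"
proof -
  obtain p where p: "\<And>n. program_time n \<le> poly p n" using program_time_poly by blast
  have "\<exists>t S. computes_in program E en f g \<I> t S \<and> t \<le> poly p n \<and> S \<in> \<I> \<and>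
      (MAX T\<in>\<I>. ratio f g T) \<le> ennreal (ratio_factor n) * ratio f g S"
    if E: "finite E" "card E = n" and en: "bij_betw en {..<n} E"
      and f: "\<forall>S\<subseteq>E. 0 \<le> f S" "mono_on (Pow E) f" "submodular_on E f"
      and g: "\<forall>S\<subseteq>E. 0 \<le> g S" "mono_on (Pow E) g" "submodular_on E g"
      and m: "matroid E \<I>"
    for n and E :: "'a set" and en f g \<I>
  proof -
    \<comment> \<open>These are the oracles that \<open>computes_in\<close> supplies, so the
      analysis of the program on index sets applies to this instance.\<close>
    define val where "val = (\<lambda>q A. case q of Numer \<Rightarrow> f (en ` A) | Denom \<Rightarrow> g (en ` A))"
    define indep where "indep = (\<lambda>A. en ` A \<in> \<I>)"
    interpret m: matroid E \<I> by (rule m)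
    have sub: "en ` A \<subseteq> E" if "A \<subseteq> {..<n}" for A using that en by (auto simp: bij_betw_def)
    interpret i: instance_run n val indep
    proof
      show "indep {}" by (simp add: indep_def m.empty_indep)
      show "0 \<le> val q A" if "A \<subseteq> {..<n}" for A q
        using sub[OF that] f(1) g(1) by (auto simp: val_def split: value_oracle.split)
    qed
    have val: "val Numer = (\<lambda>A. f (en ` A))" "val Denom = (\<lambda>A. g (en ` A))" by (auto simp: val_def)
    have rat: "ratio (val Numer) (val Denom) A = ratio f g (en ` A)" for A
      by (simp add: ratio_def val)
    have \<I>: "i.\<I> = {A. A \<subseteq> {..<n} \<and> en ` A \<in> \<I>}" unfolding i.\<I>_def by (simp add: indep_def)
    have nf: "normalized_submodular {..<n} (normalize (val Numer))"
      unfolding val by (rule normalized_submodular_pullback[OF en _ f]) simp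
    have ng: "normalized_submodular {..<n} (normalize (val Denom))"
      unfolding val by (rule normalized_submodular_pullback[OF en _ g]) simp
    have mf: "matroid_normalized_submodular {..<n} (normalize (val Numer)) i.\<I>"
      unfolding matroid_normalized_submodular_def \<I> using nf matroid_pullback[OF en _ m] by simp
    from i.wpt_program obtain t s where ex: "exec n val indep program (init n) t s"
      and t: "t \<le> program_time n" and out: "set_of n ''out'' s \<in> i.\<I>"
      and s: "ratio (val Numer) (val Denom) {} \<le> ratio (val Numer) (val Denom) (set_of n ''out'' s)"
        "\<And>x. x < n \<Longrightarrow> i.settled x (set_of n ''out'' s)"
      by (auto simp: wpt_def)
    define S where "S = en ` set_of n ''out'' s"
    have "computes_in program E en f g \<I> t S"
      using ex E by (auto simp: computes_in_def S_def val_def indep_def)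
    moreover have "t \<le> poly p n" using t p order_trans by blast
    moreover have "S \<in> \<I>" using out by (simp add: \<I> S_def)
    moreover have "(MAX T\<in>\<I>. ratio f g T) \<le> ennreal (ratio_factor n) * ratio f g S"
    proof (rule Max.boundedI)
      show "finite (ratio f g ` \<I>)"
        using m.indep_subset_ground E finite_subset[of \<I> "Pow E"] by simp
      show "ratio f g ` \<I> \<noteq> {}" using m.empty_indep by auto
      fix r assume "r \<in> ratio f g ` \<I>"
      then obtain T where T: "T \<in> \<I>" "r = ratio f g T" by auto
      \<comment> \<open>The index set of \<open>T\<close>; as \<open>en\<close> maps it onto
        \<open>T\<close>, the bound for index sets carries over.\<close>
      define X where "X = {i. i < n \<and> en i \<in> T}"
      have "T \<subseteq> E" using T m.indep_subset_ground by auto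
      then have enX: "en ` X = T" using en by (auto simp: X_def bij_betw_def)
      then have "X \<in> i.\<I>" using T by (auto simp: \<I> X_def)
      then have "ratio (val Numer) (val Denom) X \<le>
        ennreal (ratio_factor n) * ratio (val Numer) (val Denom) (set_of n ''out'' s)"
        using i.settled_bound[OF mf ng _ s(1), of X] s(2) by blast
      then show "r \<le> ennreal (ratio_factor n) * ratio f g S" by (simp add: rat enX T S_def)
    qed
    ultimately show ?thesis by blast
  qed
  then show ?thesis
    by (intro exI[of _ program] exI[of _ ratio_factor] exI[of _ p] conjI ratio_factor_bigo allI impI) blast
qed

end
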